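(* The family $\{\mathbf{P}_J\}_{J}$, indexed by all pairs of twin binary trees $J$ and defined by $$\mathbf{P}_J := \sum_{\substack{\sigma \in \mathfrak{S} \\ \mathsf{P}(\sigma) = J}} \mathbf{F}_\sigma,$$ spans a Hopf subalgebra of $\mathbf{FQSym}$ (denoted $\mathbf{Baxter}$).
   Context: $\mathbb{K}$ is a field of characteristic zero. $\mathfrak{S}$ is the set of all permutations (of all sizes $n\ge 0$), seen as words. For a word $u$ over a totally ordered alphabet, $\mathrm{std}(u)$ is the unique permutation of size $|u|$ having the same inversions as $u$. $\mathbf{FQSym}$ is the graded Hopf algebra over $\mathbb{K}$ with basis $\{\mathbf{F}_\sigma\}_{\sigma\in\mathfrak{S}}$, product $\mathbf{F}_\sigma\cdot\mathbf{F}_\nu = \sum_{\pi} \mathbf{F}_\pi$, where $\pi$ runs over all shuffles of the word $\sigma$ with the word obtained by adding $|\sigma|$ to every letter of $\nu$, and coproduct $\Delta(\mathbf{F}_\sigma) = \sum_{\sigma = uv} \mathbf{F}_{\mathrm{std}(u)} \otimes \mathbf{F}_{\mathrm{std}(v)}$ (sum over all factorizations of the word $\sigma$, empty factors allowed). A binary tree is either a leaf (empty tree) or a node with a left and a right binary subtree. The canopy of a binary tree with $n$ nodes is the word of length $n-1$ on $\{0,1\}$ obtained by reading its leaves from left to right except the first and the last one, writing $0$ if the leaf is a right child and $1$ if it is a left child. A pair of twin binary trees is a pair $(T_L,T_R)$ of binary trees with the same number $n$ of nodes whose canopies differ at every position $1 \leq i \leq n-1$. For a permutation $\sigma$, $\mathsf{P}(\sigma)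 = (T_L,T_R)$ where $T_L$ (resp. $T_R$) is the shape (labels forgotten) of the binary search tree obtained by inserting the letters of $\sigma$ from left to right (resp. from right to left) with the standard binary search tree leaf insertion (smaller letters go left, larger letters go right). This is a pair of twin binary trees. *)

theory Defs
  imports Complex_Main "HOL-Library.Poly_Mapping" "HOL-Library.Tree"
begin

section \<open>Hopf algebras on a vector space with a chosen basis\<close>

text \<open>
  A vector space with basis indexed by the type \<open>'b\<close> is modelled as the type of finitely
  supported functions \<open>'b \<Rightarrow>\<^sub>0 'k\<close>; the tensor product of two such spaces is then the space
  with basis indexed by pairs. Subspaces, spans and linear maps are those of the locale
  \<open>vector_space\<close>, with the following scalar multiplication. (The library multiplication of
  \<open>'b \<Rightarrow>\<^sub>0 'k\<close>, which exists when \<open>'b\<close> is a monoid, is not used.)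
\<close>

definition fscale :: "'k::field \<Rightarrow> ('b \<Rightarrow>\<^sub>0 'k) \<Rightarrow> ('b \<Rightarrow>\<^sub>0 'k)" where
  "fscale c x = Poly_Mapping.map ((*) c) x"

lemma lookup_fscale [simp]: "Poly_Mapping.lookup (fscale c x) b = c * Poly_Mapping.lookup x b"
  by (simp add: fscale_def Poly_Mapping.map.rep_eq when_def)

lemma vector_space_fscale: "vector_space (fscale :: 'k::field \<Rightarrow> ('b \<Rightarrow>\<^sub>0 'k) \<Rightarrow> _)"
  by unfold_locales (auto intro!: poly_mapping_eqI simp: lookup_add algebra_simps)

definition basis :: "'b \<Rightarrow> ('b \<Rightarrow>\<^sub>0 'k::field)" where
  "basis b = Poly_Mapping.single b 1"

definition lin_ext :: "('b \<Rightarrow> ('c \<Rightarrow>\<^sub>0 'k)) \<Rightarrow> ('b \<Rightarrow>\<^sub>0 'k::field) \<Rightarrow> ('c \<Rightarrow>\<^sub>0 'k)" where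
  "lin_ext f x = (\<Sum>b\<in>Poly_Mapping.keys x. fscale (Poly_Mapping.lookup x b) (f b))"

definition bilin_ext ::
    "('a \<Rightarrow> 'b \<Rightarrow> ('c \<Rightarrow>\<^sub>0 'k)) \<Rightarrow> ('a \<Rightarrow>\<^sub>0 'k::field) \<Rightarrow> ('b \<Rightarrow>\<^sub>0 'k) \<Rightarrow> ('c \<Rightarrow>\<^sub>0 'k)" where
  "bilin_ext f x y = lin_ext (\<lambda>a. lin_ext (f a) y) x"

definition tensor :: "('a \<Rightarrow>\<^sub>0 'k::field) \<Rightarrow> ('b \<Rightarrow>\<^sub>0 'k) \<Rightarrow> ('a \<times> 'b \<Rightarrow>\<^sub>0 'k)" where
  "tensor = bilin_ext (\<lambda>a b. basis (a, b))"

definition tensor_map ::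
    "(('a \<Rightarrow>\<^sub>0 'k) \<Rightarrow> ('c \<Rightarrow>\<^sub>0 'k)) \<Rightarrow> (('b \<Rightarrow>\<^sub>0 'k) \<Rightarrow> ('d \<Rightarrow>\<^sub>0 'k)) \<Rightarrow>
     ('a \<times> 'b \<Rightarrow>\<^sub>0 'k::field) \<Rightarrow> ('c \<times> 'd \<Rightarrow>\<^sub>0 'k)" where
  "tensor_map f g = lin_ext (\<lambda>(a, b). tensor (f (basis a)) (g (basis b)))"

text \<open>The tensor product of two subspaces, as a subspace of the tensor product.\<close>

definition tensor_subspace ::
    "('a \<Rightarrow>\<^sub>0 'k::field) set \<Rightarrow> ('b \<Rightarrow>\<^sub>0 'k) set \<Rightarrow> ('a \<times> 'b \<Rightarrow>\<^sub>0 'k) set" where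
  "tensor_subspace A B = module.span fscale {tensor a b | a b. a \<in> A \<and> b \<in> B}"

text \<open>The canonical isomorphism \<open>(U \<otimes> V) \<otimes> W \<cong> U \<otimes> (V \<otimes> W)\<close>.\<close>

definition tensor_assoc :: "(('a \<times> 'b) \<times> 'c \<Rightarrow>\<^sub>0 'k::field) \<Rightarrow> ('a \<times> 'b \<times> 'c \<Rightarrow>\<^sub>0 'k)" where
  "tensor_assoc = lin_ext (\<lambda>((a, b), c). basis (a, b, c))"

text \<open>A bilinear product \<open>mult\<close> on \<open>V\<close>, viewed as a map from \<open>V \<otimes> V\<close> to \<open>V\<close>.\<close>

definition mult_map ::
    "(('b \<Rightarrow>\<^sub>0 'k) \<Rightarrow> ('b \<Rightarrow>\<^sub>0 'k) \<Rightarrow> ('b \<Rightarrow>\<^sub>0 'k)) \<Rightarrow> ('b \<times> 'b \<Rightarrow>\<^sub>0 'k::field) \<Rightarrow> ('b \<Rightarrow>\<^sub>0 'k)" where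
  "mult_map mult = lin_ext (\<lambda>(a, b). mult (basis a) (basis b))"

text \<open>The product \<open>(a \<otimes> b) (c \<otimes> d) = ac \<otimes> bd\<close> on \<open>V \<otimes> V\<close>.\<close>

definition tensor_mult ::
    "(('b \<Rightarrow>\<^sub>0 'k) \<Rightarrow> ('b \<Rightarrow>\<^sub>0 'k) \<Rightarrow> ('b \<Rightarrow>\<^sub>0 'k)) \<Rightarrow>
     ('b \<times> 'b \<Rightarrow>\<^sub>0 'k::field) \<Rightarrow> ('b \<times> 'b \<Rightarrow>\<^sub>0 'k) \<Rightarrow> ('b \<times> 'b \<Rightarrow>\<^sub>0 'k)" where
  "tensor_mult mult =
     bilin_ext (\<lambda>(a, b) (c, d). tensor (mult (basis a) (basis c)) (mult (basis b) (basis d)))"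

definition is_antipode ::
    "(('b \<Rightarrow>\<^sub>0 'k) \<Rightarrow> ('b \<Rightarrow>\<^sub>0 'k) \<Rightarrow> ('b \<Rightarrow>\<^sub>0 'k)) \<Rightarrow> ('b \<Rightarrow>\<^sub>0 'k::field) \<Rightarrow>
     (('b \<Rightarrow>\<^sub>0 'k) \<Rightarrow> ('b \<times> 'b \<Rightarrow>\<^sub>0 'k)) \<Rightarrow> (('b \<Rightarrow>\<^sub>0 'k) \<Rightarrow> 'k) \<Rightarrow>
     (('b \<Rightarrow>\<^sub>0 'k) \<Rightarrow> ('b \<Rightarrow>\<^sub>0 'k)) \<Rightarrow> bool" where
  "is_antipode mult one comult counit S \<longleftrightarrow>
     Vector_Spaces.linear fscale fscale S \<and>
     (\<forall>x. mult_map mult (tensor_map S id (comult x)) = fscale (counit x) one) \<and>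
     (\<forall>x. mult_map mult (tensor_map id S (comult x)) = fscale (counit x) one)"

locale hopf_algebra =
  fixes mult :: "('b \<Rightarrow>\<^sub>0 'k::field) \<Rightarrow> ('b \<Rightarrow>\<^sub>0 'k) \<Rightarrow> ('b \<Rightarrow>\<^sub>0 'k)"
    and one :: "'b \<Rightarrow>\<^sub>0 'k"
    and comult :: "('b \<Rightarrow>\<^sub>0 'k) \<Rightarrow> ('b \<times> 'b \<Rightarrow>\<^sub>0 'k)"
    and counit :: "('b \<Rightarrow>\<^sub>0 'k) \<Rightarrow> 'k"
    and antipode :: "('b \<Rightarrow>\<^sub>0 'k) \<Rightarrow> ('b \<Rightarrow>\<^sub>0 'k)"
  assumes mult_linear_left: "Vector_Spaces.linear fscale fscale (\<lambda>x. mult x y)"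
    and mult_linear_right: "Vector_Spaces.linear fscale fscale (mult x)"
    and mult_assoc: "mult (mult x y) z = mult x (mult y z)"
    and one_mult: "mult one x = x"
    and mult_one: "mult x one = x"
    and comult_linear: "Vector_Spaces.linear fscale fscale comult"
    and counit_linear: "Vector_Spaces.linear fscale (*) counit"
    and comult_coassoc:
      "tensor_assoc (tensor_map comult id (comult x)) = tensor_map id comult (comult x)"
    and counit_left: "lin_ext (\<lambda>(a, b). fscale (counit (basis a)) (basis b)) (comult x) = x"
    and counit_right: "lin_ext (\<lambda>(a, b). fscale (counit (basis b)) (basis a)) (comult x) = x"
    and comult_mult: "comult (mult x y) = tensor_mult mult (comult x) (comult y)"
    and comult_one: "comult one = tensor one one"
    and counit_mult: "counit (mult x y) = counit x * counit y"
    and counit_one: "counit one = 1"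
    and antipode: "is_antipode mult one comult counit antipode"

locale hopf_subalgebra = hopf_algebra mult one comult counit antipode
  for mult :: "('b \<Rightarrow>\<^sub>0 'k::field) \<Rightarrow> ('b \<Rightarrow>\<^sub>0 'k) \<Rightarrow> ('b \<Rightarrow>\<^sub>0 'k)"
    and one comult counit antipode +
  fixes B :: "('b \<Rightarrow>\<^sub>0 'k) set"
  assumes subspace: "module.subspace fscale B"
    and one_closed: "one \<in> B"
    and mult_closed: "x \<in> B \<Longrightarrow> y \<in> B \<Longrightarrow> mult x y \<in> B"
    and comult_closed: "x \<in> B \<Longrightarrow> comult x \<in> tensor_subspace B B"
    and antipode_closed: "x \<in> B \<Longrightarrow> antipode x \<in> B"


section \<open>The Hopf algebra \<open>FQSym\<close>\<close>

typedef perm_word = "{w :: nat list. distinct w \<and> set w = {1..length w}}"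
  morphisms word_of Perm_Word
  by (rule exI[of _ "[]"]) simp

definition perm_size :: "perm_word \<Rightarrow> nat" where
  "perm_size \<sigma> = length (word_of \<sigma>)"

definition std :: "'a::linorder list \<Rightarrow> perm_word" where
  "std u = (THE \<sigma>. perm_size \<sigma> = length u \<and>
     (\<forall>i j. i < j \<and> j < length u \<longrightarrow> (word_of \<sigma> ! i > word_of \<sigma> ! j \<longleftrightarrow> u ! i > u ! j)))"

type_synonym 'k fqsym = "perm_word \<Rightarrow>\<^sub>0 'k"

abbreviation F :: "perm_word \<Rightarrow> 'k::field fqsym" where
  "F \<equiv> basis"

text \<open>
  The two shuffled words have disjoint alphabets, so no word arises twice as a shuffle and
  the set of shuffles carries no multiplicities.
\<close>

definition fq_mult :: "'k::field fqsym \<Rightarrow> 'k fqsym \<Rightarrow> 'k fqsym" where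
  "fq_mult = bilin_ext (\<lambda>\<sigma> \<nu>.
     \<Sum>\<pi> | word_of \<pi> \<in> shuffles (word_of \<sigma>) (map (\<lambda>i. i + perm_size \<sigma>) (word_of \<nu>)). F \<pi>)"

definition fq_one :: "'k::field fqsym" where
  "fq_one = F (Perm_Word [])"

definition fq_comult :: "'k::field fqsym \<Rightarrow> (perm_word \<times> perm_word \<Rightarrow>\<^sub>0 'k)" where
  "fq_comult = lin_ext (\<lambda>\<sigma>.
     \<Sum>k\<le>perm_size \<sigma>. tensor (F (std (take k (word_of \<sigma>)))) (F (std (drop k (word_of \<sigma>)))))"

definition fq_counit :: "'k::field fqsym \<Rightarrow> 'k" where
  "fq_counit x = Poly_Mapping.lookup x (Perm_Word [])"

text \<open>An antipode of a bialgebra is unique when it exists.\<close>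

definition fq_antipode :: "'k::field fqsym \<Rightarrow> 'k fqsym" where
  "fq_antipode = (THE S. is_antipode fq_mult fq_one fq_comult fq_counit S)"


section \<open>Twin binary trees and the \<open>P\<close>-symbol\<close>

text \<open>Unlabelled binary trees are trees with labels in \<open>unit\<close>; \<open>size\<close> counts the nodes.\<close>

type_synonym shape = "unit tree"

text \<open>
  The leaves from left to right: \<open>0\<close> for a right child, \<open>1\<close> for a left child. The argument
  \<open>d\<close> is the entry used if the tree is itself a leaf. At top level its value is immaterial,
  since the first and last leaves are dropped.
\<close>

fun leaf_word :: "nat \<Rightarrow> 'a tree \<Rightarrow> nat list" where
  "leaf_word d Leaf = [d]"
| "leaf_word d (Node l a r) = leaf_word 1 l @ leaf_word 0 r"

definition canopy :: "'a tree \<Rightarrow> nat list" where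
  "canopy t = butlast (tl (leaf_word 0 t))"

definition twin :: "shape \<times> shape \<Rightarrow> bool" where
  "twin J \<longleftrightarrow> size (fst J) = size (snd J) \<and>
     (\<forall>i < size (fst J) - 1. canopy (fst J) ! i \<noteq> canopy (snd J) ! i)"

fun bst_insert :: "'a::linorder \<Rightarrow> 'a tree \<Rightarrow> 'a tree" where
  "bst_insert x Leaf = Node Leaf x Leaf"
| "bst_insert x (Node l a r) =
     (if x < a then Node (bst_insert x l) a r else Node l a (bst_insert x r))"

definition shape_of :: "'a tree \<Rightarrow> shape" where
  "shape_of = map_tree (\<lambda>_. ())"

definition P_symbol :: "perm_word \<Rightarrow> shape \<times> shape" where
  "P_symbol \<sigma> =
     (shape_of (fold bst_insert (word_of \<sigma>) Leaf),
      shape_of (fold bst_insert (rev (word_of \<sigma>)) Leaf))"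

definition baxter_P :: "shape \<times> shape \<Rightarrow> 'k::field fqsym" where
  "baxter_P J = (\<Sum>\<sigma> | P_symbol \<sigma> = J. F \<sigma>)"

end

theory Submission
  imports Defs
begin

text \<open>
  \<open>FQSym\<close> is a connected graded bialgebra, so it has a unique antipode, the geometric series
  in \<open>id - \<eta>\<epsilon>\<close> for the convolution product. On elements of bounded degree this series is a
  finite sum, hence the antipode preserves every sub-bialgebra.

  The span of the \<open>P\<^sub>J\<close> consists of the elements whose coefficients depend only on the
  \<open>P\<close>-symbol. The coefficient of \<open>\<pi>\<close> in \<open>x y\<close> only involves the restrictions of \<open>\<pi>\<close> to the
  letters \<open>\<le> k\<close> and \<open>> k\<close>, and the search tree of a restriction of a word to an interval
  is obtained by pruning the search tree of the word. The coefficient of \<open>\<mu> \<otimes> \<nu>\<close> in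
  \<open>\<Delta>(x)\<close> is a sum of coefficients of \<open>x\<close> at concatenations \<open>u v\<close> with \<open>std u = \<mu>\<close> and
  \<open>std v = \<nu>\<close>, and the search tree of \<open>u v\<close> is determined by those of \<open>u\<close> and \<open>v\<close>.
\<close>

section \<open>Linear algebra on finitely supported functions\<close>

text \<open>Both structure maps are defined on basis elements, whereas membership in the span is a
  condition on coefficients. Each map is therefore transposed once (\<open>lookup_fq_mult\<close>,
  \<open>lookup_fq_comult\<close>); closure then becomes a statement about single permutations and
  the relation of having the same \<open>P_symbol\<close>. Shapes are awkward for this, since
  pruning and joining compare letters. The letters of a permutation are 1..n and the inorder reading
  of its search tree is sorted, so equal shapes force equal labelled trees
  (\<open>P_symbol_eq_iff\<close>), and the work is done on labelled trees. Canopies serve to show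
  that every \<open>P_symbol\<close> is a twin pair: the fibre sums used to expand an element must
  belong to the indexed family. \<open>std\<close> and \<open>fq_antipode\<close> are definite
  descriptions. The first is made explicit by ranks; for the second, uniqueness is that of inverses
  in the convolution monoid.\<close>

interpretation fs: vector_space "fscale :: 'k::field \<Rightarrow> ('b \<Rightarrow>\<^sub>0 'k) \<Rightarrow> _"
  by (rule vector_space_fscale)

abbreviation flin :: "(('a \<Rightarrow>\<^sub>0 'k::field) \<Rightarrow> ('b \<Rightarrow>\<^sub>0 'k)) \<Rightarrow> bool" where
  "flin \<equiv> Vector_Spaces.linear fscale fscale"

lemma flin_iff: "flin f \<longleftrightarrow> (\<forall>x y. f (x + y) = f x + f y) \<and> (\<forall>c x. f (fscale c x) = fscale c (f x))"
  by (auto simp: Vector_Spaces.linear_iff vector_space_fscale)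

lemma flinI:
  assumes "\<And>x y. f (x + y) = f x + f y" "\<And>c x. f (fscale c x) = fscale c (f x)"
  shows "flin f"
  using assms by (simp add: flin_iff)

lemma flin_add: "flin f \<Longrightarrow> f (x + y) = f x + f y"
  and flin_scale: "flin f \<Longrightarrow> f (fscale c x) = fscale c (f x)"
  by (auto simp: flin_iff)

lemma flin_zero: "flin f \<Longrightarrow> f 0 = 0"
  using flin_scale[of f 0 0] by simp

lemma flin_sum: "flin f \<Longrightarrow> f (sum g A) = (\<Sum>a\<in>A. f (g a))"
  by (induction A rule: infinite_finite_induct) (auto simp: flin_zero flin_add)

lemma flin_id: "flin (\<lambda>x. x)"
  and flin_id': "flin id"
  by (auto intro: flinI)

lemma flin_comp: "flin f \<Longrightarrow> flin g \<Longrightarrow> flin (\<lambda>x. f (g x))"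
  by (simp add: flin_iff)

lemma flin_plus: "flin f \<Longrightarrow> flin g \<Longrightarrow> flin (\<lambda>x. f x + g x)"
  by (simp add: flin_iff fs.scale_right_distrib algebra_simps)

lemma flin_fscale: "flin f \<Longrightarrow> flin (\<lambda>x. fscale c (f x))"
  by (simp add: flin_iff fs.scale_right_distrib fs.scale_left_commute)

lemma flin_setsum: "(\<And>a. a \<in> A \<Longrightarrow> flin (f a)) \<Longrightarrow> flin (\<lambda>x. \<Sum>a\<in>A. f a x)"
  by (auto intro!: flinI simp: flin_add flin_scale sum.distrib fs.scale_sum_right)

lemma lookup_basis: "Poly_Mapping.lookup (basis b) c = (if b = c then 1 else 0)"
  by (simp add: basis_def lookup_single when_def)

lemma keys_basis [simp]: "Poly_Mapping.keys (basis b :: _ \<Rightarrow>\<^sub>0 'k::field) = {b}"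
  by (simp add: basis_def)

lemma lin_ext_superset:
  assumes "finite A" "Poly_Mapping.keys x \<subseteq> A"
  shows "lin_ext f x = (\<Sum>b\<in>A. fscale (Poly_Mapping.lookup x b) (f b))"
  unfolding lin_ext_def
  by (rule sum.mono_neutral_left) (use assms in \<open>auto simp: in_keys_iff\<close>)

lemma flin_lin_ext: "flin (lin_ext (f :: 'a \<Rightarrow> ('b \<Rightarrow>\<^sub>0 'k::field)))"
proof (rule flinI)
  fix x y :: "'a \<Rightarrow>\<^sub>0 'k" and c
  let ?A = "Poly_Mapping.keys x \<union> Poly_Mapping.keys y"
  have "Poly_Mapping.keys (x + y) \<subseteq> ?A" by (rule Poly_Mapping.keys_add)
  then show "lin_ext f (x + y) = lin_ext f x + lin_ext f y"
    by (simp add: lin_ext_superset[of ?A] lookup_add fs.scale_left_distrib sum.distrib)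
  have "Poly_Mapping.keys (fscale c x) \<subseteq> Poly_Mapping.keys x"
    by (auto simp: in_keys_iff)
  then show "lin_ext f (fscale c x) = fscale c (lin_ext f x)"
    by (simp add: lin_ext_superset[of "Poly_Mapping.keys x"] fs.scale_sum_right)
qed

lemma lin_ext_basis [simp]: "lin_ext f (basis b) = f b"
  by (simp add: lin_ext_def lookup_basis)

lemma basis_expansion: "x = (\<Sum>b\<in>Poly_Mapping.keys x. fscale (Poly_Mapping.lookup x b) (basis b))"
  by (rule poly_mapping_eqI) (simp add: lookup_sum lookup_basis if_distrib in_keys_iff cong: if_cong)

lemma flin_eq_on_keys:
  assumes "flin f" "flin g" "\<And>b. b \<in> Poly_Mapping.keys x \<Longrightarrow> f (basis b) = g (basis b)"
  shows "f x = g x"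
proof -
  have "h x = (\<Sum>b\<in>Poly_Mapping.keys x. fscale (Poly_Mapping.lookup x b) (h (basis b)))" if "flin h" for h
    by (subst basis_expansion) (simp add: flin_sum[OF that] flin_scale[OF that])
  from this[OF assms(1)] this[OF assms(2)] assms(3) show ?thesis by simp
qed

lemma flin_eqI:
  assumes "flin f" "flin g" "\<And>b. f (basis b) = g (basis b)"
  shows "f x = g x"
  using assms by (rule flin_eq_on_keys)

text \<open>The field is embedded as the one-dimensional space of functions on \<open>unit\<close>,
  which reduces functionals to \<open>flin_eqI\<close>. Applied to coefficient functionals, this is
  how the transposed formulas are proved.\<close>

lemma functional_eqI:
  fixes \<phi> \<psi> :: "('b \<Rightarrow>\<^sub>0 'k::field) \<Rightarrow> 'k"
  assumes "\<And>x y. \<phi> (x + y) = \<phi> x + \<phi> y" "\<And>c x. \<phi> (fscale c x) = c * \<phi> x"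
    and "\<And>x y. \<psi> (x + y) = \<psi> x + \<psi> y" "\<And>c x. \<psi> (fscale c x) = c * \<psi> x"
    and "\<And>b. \<phi> (basis b) = \<psi> (basis b)"
  shows "\<phi> x = \<psi> x"
proof -
  have "fscale (\<phi> x) (basis ()) = fscale (\<psi> x) (basis ())"
    by (rule flin_eqI[where x = x]) (auto intro!: flinI simp: assms fs.scale_left_distrib)
  then have "Poly_Mapping.lookup (fscale (\<phi> x) (basis ())) () = Poly_Mapping.lookup (fscale (\<psi> x) (basis ())) ()"
    by (rule arg_cong)
  then show ?thesis by (simp add: lookup_basis)
qed

lemma flin_lin_ext_param:
  assumes "\<And>a. flin (\<lambda>y. f y a)"
  shows "flin (\<lambda>y. lin_ext (f y) x)"
  unfolding lin_ext_def by (intro flin_setsum flin_fscale assms)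

lemma flin_bilin_ext_left: "flin (\<lambda>x. bilin_ext f x y)"
  unfolding bilin_ext_def by (rule flin_lin_ext)

lemma flin_bilin_ext_right: "flin (bilin_ext f x)"
  unfolding bilin_ext_def by (intro flin_lin_ext_param flin_lin_ext)

lemma bilin_ext_basis [simp]: "bilin_ext f (basis a) (basis b) = f a b"
  by (simp add: bilin_ext_def)

lemma bilin_eqI:
  assumes "\<And>y. flin (\<lambda>x. f x y)" "\<And>x. flin (f x)" "\<And>y. flin (\<lambda>x. g x y)" "\<And>x. flin (g x)"
    and "\<And>a b. f (basis a) (basis b) = g (basis a) (basis b)"
  shows "f x y = g x y"
proof (rule flin_eqI[OF assms(1,3)])
  fix a show "f (basis a) y = g (basis a) y"
    by (rule flin_eqI[OF assms(2,4,5)])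
qed

lemma flin_tensor_left: "flin (\<lambda>x. tensor x y)"
  and flin_tensor_right: "flin (tensor x)"
  unfolding tensor_def by (rule flin_bilin_ext_left flin_bilin_ext_right)+

lemma tensor_basis [simp]: "tensor (basis a) (basis b) = basis (a, b)"
  by (simp add: tensor_def)

lemma lookup_tensor:
  "Poly_Mapping.lookup (tensor x y) (a, b) = Poly_Mapping.lookup x a * Poly_Mapping.lookup y b"
proof (rule functional_eqI[where x = x])
  fix c show "Poly_Mapping.lookup (tensor (basis c) y) (a, b) =
      Poly_Mapping.lookup (basis c) a * Poly_Mapping.lookup y b"
    by (rule functional_eqI[where x = y])
      (simp_all add: flin_add[OF flin_tensor_right] flin_scale[OF flin_tensor_right]
        lookup_add lookup_basis algebra_simps)
qed (simp_all add: flin_add[OF flin_tensor_left] flin_scale[OF flin_tensor_left] lookup_add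
    algebra_simps)

lemma tensor_eqI:
  assumes "flin f" "flin g" "\<And>a b. f (tensor (basis a) (basis b)) = g (tensor (basis a) (basis b))"
  shows "f z = g z"
  by (rule flin_eqI[OF assms(1,2)]) (use assms(3) in auto)

lemma flin_tensor_map: "flin (tensor_map f g)"
  unfolding tensor_map_def by (rule flin_lin_ext)

lemma tensor_map_basis [simp]: "tensor_map f g (basis (a, b)) = tensor (f (basis a)) (g (basis b))"
  by (simp add: tensor_map_def)

lemma tensor_map_tensor:
  assumes "flin f" "flin g"
  shows "tensor_map f g (tensor x y) = tensor (f x) (g y)"
  by (rule bilin_eqI[where x = x and y = y])
    (auto intro!: flin_comp[OF flin_tensor_map] flin_comp[OF flin_tensor_left] flin_tensor_left
      flin_tensor_right flin_comp[OF flin_tensor_right] assms)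

lemma flin_tensor_assoc: "flin tensor_assoc"
  unfolding tensor_assoc_def by (rule flin_lin_ext)

lemma tensor_assoc_basis [simp]: "tensor_assoc (basis ((a, b), c)) = basis (a, b, c)"
  by (simp add: tensor_assoc_def)

lemma tensor_assoc_tensor: "tensor_assoc (tensor (tensor x y) z) = tensor x (tensor y z)"
proof (rule flin_eqI[where x = z])
  fix c
  show "tensor_assoc (tensor (tensor x y) (basis c)) = tensor x (tensor y (basis c))"
    by (rule bilin_eqI[where x = x and y = y])
      (auto intro!: flin_comp[OF flin_tensor_assoc] flin_comp[OF flin_tensor_left] flin_tensor_left
      flin_tensor_right flin_comp[OF flin_tensor_right])
qed (auto intro!: flin_comp[OF flin_tensor_assoc] flin_comp[OF flin_tensor_right] flin_tensor_right)

lemma tensor3_eqI: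
  assumes "flin f" "flin g" "\<And>a b c. f (tensor (tensor (basis a) (basis b)) (basis c)) =
    g (tensor (tensor (basis a) (basis b)) (basis c))"
  shows "f z = g z"
  by (rule flin_eqI[OF assms(1,2)]) (use assms(3) in auto)

lemma flin_mult_map: "flin (mult_map m)"
  unfolding mult_map_def by (rule flin_lin_ext)

lemma mult_map_basis [simp]: "mult_map m (basis (a, b)) = m (basis a) (basis b)"
  by (simp add: mult_map_def)

lemma mult_map_tensor:
  assumes "\<And>y. flin (\<lambda>x. m x y)" "\<And>x. flin (m x)"
  shows "mult_map m (tensor x y) = m x y"
  by (rule bilin_eqI[where x = x and y = y])
    (auto intro!: flin_comp[OF flin_mult_map] flin_tensor_left flin_tensor_right assms)

lemma flin_tensor_mult_left: "flin (\<lambda>x. tensor_mult m x y)"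
  and flin_tensor_mult_right: "flin (tensor_mult m x)"
  unfolding tensor_mult_def by (rule flin_bilin_ext_left flin_bilin_ext_right)+

lemma tensor_mult_basis [simp]:
  "tensor_mult m (basis (a, b)) (basis (c, d)) = tensor (m (basis a) (basis c)) (m (basis b) (basis d))"
  by (simp add: tensor_mult_def)

lemma tensor_mult_tensor:
  assumes "\<And>y. flin (\<lambda>x. m x y)" "\<And>x. flin (m x)"
  shows "tensor_mult m (tensor a b) (tensor c d) = tensor (m a c) (m b d)"
proof (rule bilin_eqI[where x = a and y = b])
  fix a b
  show "tensor_mult m (tensor (basis a) (basis b)) (tensor c d) = tensor (m (basis a) c) (m (basis b) d)"
    by (rule bilin_eqI[where x = c and y = d])
      (auto intro!: flin_tensor_left flin_tensor_right flin_comp[OF flin_tensor_left]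
        flin_comp[OF flin_tensor_right] flin_comp[OF flin_tensor_mult_right] assms)
qed (auto intro!: flin_tensor_left flin_tensor_right flin_comp[OF flin_tensor_left]
     flin_comp[OF flin_tensor_right] flin_comp[OF flin_tensor_mult_left] assms)

lemma tensor_in_tensor_subspace: "a \<in> A \<Longrightarrow> b \<in> B \<Longrightarrow> tensor a b \<in> tensor_subspace A B"
  unfolding tensor_subspace_def by (rule fs.span_base) auto

text \<open>Used with S the pure tensors from a subspace: a convolution is a linear map applied to
  the coproduct, so only its values on pure tensors need checking.\<close>

lemma flin_image_span:
  assumes "flin f" "z \<in> fs.span S" "fs.subspace B" "\<And>x. x \<in> S \<Longrightarrow> f x \<in> B"
  shows "f z \<in> B"
  using assms(2)
proof (induction rule: fs.span_induct_alt)
  case base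
  then show ?case using assms(1,3) by (simp add: flin_zero fs.subspace_0)
next
  case (step c x y)
  then show ?case
    using assms by (simp add: flin_add flin_scale fs.subspace_add fs.subspace_scale)
qed

section \<open>The antipode of a connected bialgebra\<close>

text \<open>The axioms of \<open>hopf_algebra\<close> without the antipode, which is constructed
  from them.\<close>

locale bialgebra =
  fixes mult :: "('b \<Rightarrow>\<^sub>0 'k::field) \<Rightarrow> ('b \<Rightarrow>\<^sub>0 'k) \<Rightarrow> ('b \<Rightarrow>\<^sub>0 'k)"
    and one :: "'b \<Rightarrow>\<^sub>0 'k"
    and comult :: "('b \<Rightarrow>\<^sub>0 'k) \<Rightarrow> ('b \<times> 'b \<Rightarrow>\<^sub>0 'k)"
    and counit :: "('b \<Rightarrow>\<^sub>0 'k) \<Rightarrow> 'k"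
  assumes mult_linear_left: "flin (\<lambda>x. mult x y)"
    and mult_linear_right: "flin (mult x)"
    and mult_assoc: "mult (mult x y) z = mult x (mult y z)"
    and one_mult: "mult one x = x"
    and mult_one: "mult x one = x"
    and comult_linear: "flin comult"
    and counit_linear: "Vector_Spaces.linear fscale (*) counit"
    and comult_coassoc:
      "tensor_assoc (tensor_map comult id (comult x)) = tensor_map id comult (comult x)"
    and counit_left: "lin_ext (\<lambda>(a, b). fscale (counit (basis a)) (basis b)) (comult x) = x"
    and counit_right: "lin_ext (\<lambda>(a, b). fscale (counit (basis b)) (basis a)) (comult x) = x"
    and comult_mult: "comult (mult x y) = tensor_mult mult (comult x) (comult y)"
    and comult_one: "comult one = tensor one one"
    and counit_mult: "counit (mult x y) = counit x * counit y"
    and counit_one: "counit one = 1"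
begin

text \<open>Convolution makes the linear endomorphisms a monoid with unit \<open>conv_unit\<close>,
  the map \<eta>\<epsilon>; an antipode is exactly a two-sided inverse of \<open>id\<close>.\<close>

definition conv :: "(('b \<Rightarrow>\<^sub>0 'k) \<Rightarrow> ('b \<Rightarrow>\<^sub>0 'k)) \<Rightarrow> (('b \<Rightarrow>\<^sub>0 'k) \<Rightarrow> ('b \<Rightarrow>\<^sub>0 'k)) \<Rightarrow> ('b \<Rightarrow>\<^sub>0 'k) \<Rightarrow> ('b \<Rightarrow>\<^sub>0 'k)" where
  "conv f g x = mult_map mult (tensor_map f g (comult x))"

definition conv_unit :: "('b \<Rightarrow>\<^sub>0 'k) \<Rightarrow> ('b \<Rightarrow>\<^sub>0 'k)" where
  "conv_unit x = fscale (counit x) one"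

lemmas mult_map_tensor' = mult_map_tensor[OF mult_linear_left mult_linear_right]

lemma flin_conv: "flin (conv f g)"
  unfolding conv_def by (intro flin_comp[OF flin_mult_map] flin_comp[OF flin_tensor_map] comult_linear)

lemma counit_add: "counit (x + y) = counit x + counit y"
  and counit_scale: "counit (fscale c x) = c * counit x"
  using counit_linear by (auto simp: Vector_Spaces.linear_iff)

lemma flin_conv_unit: "flin conv_unit"
  by (rule flinI) (simp_all add: conv_unit_def counit_add counit_scale fs.scale_left_distrib)

text \<open>Facts 1 and 2 extract the inner coproduct from the nested convolution, fact 3 rebrackets
  the triple product by associativity, and coassociativity identifies the two iterated
  coproducts.\<close>

lemma conv_assoc:
  assumes f: "flin f" and g: "flin g" and h: "flin h"
  shows "conv (conv f g) h x = conv f (conv g h) x"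
proof -
  let ?mm = "mult_map mult"
  have fg: "flin (\<lambda>w. ?mm (tensor_map f g w))" and gh: "flin (\<lambda>w. ?mm (tensor_map g h w))"
    by (intro flin_comp[OF flin_mult_map] flin_tensor_map)+
  have 1: "tensor_map (conv f g) h z = tensor_map (\<lambda>w. ?mm (tensor_map f g w)) h (tensor_map comult id z)" for z
  proof (rule tensor_eqI[where z = z, OF flin_tensor_map flin_comp[OF flin_tensor_map flin_tensor_map]])
    fix a b
    show "tensor_map (conv f g) h (tensor (basis a) (basis b)) =
        tensor_map (\<lambda>w. ?mm (tensor_map f g w)) h (tensor_map comult id (tensor (basis a) (basis b)))"
      by (simp only: tensor_map_tensor[OF flin_conv h] tensor_map_tensor[OF comult_linear flin_id']
          tensor_map_tensor[OF fg h] conv_def id_apply)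
  qed
  have 2: "tensor_map f (conv g h) z = tensor_map f (\<lambda>w. ?mm (tensor_map g h w)) (tensor_map id comult z)" for z
  proof (rule tensor_eqI[where z = z, OF flin_tensor_map flin_comp[OF flin_tensor_map flin_tensor_map]])
    fix a b
    show "tensor_map f (conv g h) (tensor (basis a) (basis b)) =
        tensor_map f (\<lambda>w. ?mm (tensor_map g h w)) (tensor_map id comult (tensor (basis a) (basis b)))"
      by (simp only: tensor_map_tensor[OF f flin_conv] tensor_map_tensor[OF flin_id' comult_linear]
          tensor_map_tensor[OF f gh] conv_def id_apply)
  qed
  have 3: "?mm (tensor_map (\<lambda>w. ?mm (tensor_map f g w)) h z)
      = ?mm (tensor_map f (\<lambda>w. ?mm (tensor_map g h w)) (tensor_assoc z))" for z
  proof (rule tensor3_eqI[where z = z])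
    fix a b c
    show "?mm (tensor_map (\<lambda>w. ?mm (tensor_map f g w)) h (tensor (tensor (basis a) (basis b)) (basis c)))
      = ?mm (tensor_map f (\<lambda>w. ?mm (tensor_map g h w)) (tensor_assoc (tensor (tensor (basis a) (basis b)) (basis c))))"
      by (simp only: tensor_map_tensor[OF fg h] tensor_map_tensor[OF f gh] tensor_assoc_tensor
          tensor_map_tensor[OF f g] tensor_map_tensor[OF g h] mult_map_tensor' mult_assoc)
  qed (intro flin_comp[OF flin_mult_map] flin_comp[OF flin_tensor_map] flin_tensor_map flin_tensor_assoc)+
  show ?thesis
    unfolding conv_def[of "conv f g"] conv_def[of f "conv g h"] 1 2 3 comult_coassoc ..
qed

lemma conv_unit_left:
  assumes f: "flin f"
  shows "conv conv_unit f x = f x"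
proof -
  have "mult_map mult (tensor_map conv_unit f z) =
      f (lin_ext (\<lambda>(a, b). fscale (counit (basis a)) (basis b)) z)" for z
    by (rule flin_eqI[where x = z])
      (auto intro!: flin_comp[OF flin_mult_map] flin_comp[OF f] flin_tensor_map flin_lin_ext
        simp: mult_map_tensor' conv_unit_def flin_scale[OF mult_linear_left] one_mult flin_scale[OF f])
  then show ?thesis by (simp add: conv_def counit_left)
qed

lemma conv_unit_right:
  assumes f: "flin f"
  shows "conv f conv_unit x = f x"
proof -
  have "mult_map mult (tensor_map f conv_unit z) =
      f (lin_ext (\<lambda>(a, b). fscale (counit (basis b)) (basis a)) z)" for z
    by (rule flin_eqI[where x = z])
      (auto intro!: flin_comp[OF flin_mult_map] flin_comp[OF f] flin_tensor_map flin_lin_ext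
        simp: mult_map_tensor' conv_unit_def flin_scale[OF mult_linear_right] mult_one flin_scale[OF f])
  then show ?thesis by (simp add: conv_def counit_right)
qed

lemma is_antipode_iff:
  "is_antipode mult one comult counit S \<longleftrightarrow>
     flin S \<and> conv S id = conv_unit \<and> conv id S = conv_unit"
  by (simp add: is_antipode_def conv_def conv_unit_def fun_eq_iff)

text \<open>Inverses in a monoid agree: S = S * (id * S') = (S * id) * S' = S'.\<close>

lemma antipode_unique:
  assumes "is_antipode mult one comult counit S" "is_antipode mult one comult counit S'"
  shows "S = S'"
proof
  fix x
  have S: "flin S" "conv S id = conv_unit" and S': "flin S'" "conv id S' = conv_unit"
    using assms by (auto simp: is_antipode_iff)
  have "S x = conv S (conv id S') x" by (simp add: S' conv_unit_right S)
  also have "\<dots> = conv (conv S id) S' x" by (rule conv_assoc[OF S(1) flin_id' S'(1), symmetric])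
  also have "\<dots> = S' x" by (simp add: S conv_unit_left S')
  finally show "S x = S' x" .
qed

lemma conv_add_left: "conv (\<lambda>x. f x + g x) h x = conv f h x + conv g h x"
proof -
  have "tensor_map (\<lambda>x. f x + g x) h z = tensor_map f h z + tensor_map g h z" for z
    by (rule flin_eqI[where x = z])
      (auto intro!: flin_plus flin_tensor_map simp: flin_add[OF flin_tensor_left])
  then show ?thesis by (simp add: conv_def flin_add[OF flin_mult_map])
qed

lemma conv_add_right: "conv h (\<lambda>x. f x + g x) x = conv h f x + conv h g x"
proof -
  have "tensor_map h (\<lambda>x. f x + g x) z = tensor_map h f z + tensor_map h g z" for z
    by (rule flin_eqI[where x = z])
      (auto intro!: flin_plus flin_tensor_map simp: flin_add[OF flin_tensor_right])
  then show ?thesis by (simp add: conv_def flin_add[OF flin_mult_map])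
qed

lemma conv_scale_left: "conv (\<lambda>x. fscale c (f x)) h x = fscale c (conv f h x)"
proof -
  have "tensor_map (\<lambda>x. fscale c (f x)) h z = fscale c (tensor_map f h z)" for z
    by (rule flin_eqI[where x = z])
      (auto intro!: flin_fscale flin_tensor_map simp: flin_scale[OF flin_tensor_left])
  then show ?thesis by (simp add: conv_def flin_scale[OF flin_mult_map])
qed

lemma conv_scale_right: "conv h (\<lambda>x. fscale c (f x)) x = fscale c (conv h f x)"
proof -
  have "tensor_map h (\<lambda>x. fscale c (f x)) z = fscale c (tensor_map h f z)" for z
    by (rule flin_eqI[where x = z])
      (auto intro!: flin_fscale flin_tensor_map simp: flin_scale[OF flin_tensor_right])
  then show ?thesis by (simp add: conv_def flin_scale[OF flin_mult_map])
qed

text \<open>This is id - \<eta>\<epsilon>, the projection onto the kernel of the counit along the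
  unit.\<close>

definition reduced :: "('b \<Rightarrow>\<^sub>0 'k) \<Rightarrow> ('b \<Rightarrow>\<^sub>0 'k)" where
  "reduced x = x + fscale (-1) (conv_unit x)"

lemma flin_reduced: "flin reduced"
  unfolding reduced_def by (intro flin_plus flin_id flin_fscale flin_conv_unit)

lemma id_eq_reduced: "id = (\<lambda>x. conv_unit x + reduced x)"
  by (simp add: fun_eq_iff reduced_def)

primrec reduced_power :: "nat \<Rightarrow> ('b \<Rightarrow>\<^sub>0 'k) \<Rightarrow> ('b \<Rightarrow>\<^sub>0 'k)" where
  "reduced_power 0 = conv_unit"
| "reduced_power (Suc n) = conv reduced (reduced_power n)"

lemma flin_reduced_power: "flin (reduced_power n)"
  by (cases n) (simp_all add: flin_conv_unit flin_conv)

text \<open>Powers are built by multiplying on the left; commuting with \<open>reduced\<close> lets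
  the same series invert \<open>id\<close> on both sides.\<close>

lemma reduced_power_Suc_right: "conv (reduced_power n) reduced = reduced_power (Suc n)"
proof (induction n)
  case 0
  show ?case by (simp add: fun_eq_iff conv_unit_left conv_unit_right flin_reduced)
next
  case (Suc n)
  have "conv (reduced_power (Suc n)) reduced = conv reduced (conv (reduced_power n) reduced)"
    by (simp add: fun_eq_iff conv_assoc flin_reduced flin_reduced_power)
  then show ?case by (simp add: Suc)
qed

text \<open>
  The partial sums of the geometric series for the convolution inverse of
  \<open>id = conv_unit + reduced\<close>.
\<close>

primrec antipode_sum :: "nat \<Rightarrow> ('b \<Rightarrow>\<^sub>0 'k) \<Rightarrow> ('b \<Rightarrow>\<^sub>0 'k)" where
  "antipode_sum 0 = conv_unit"
| "antipode_sum (Suc n) = (\<lambda>x. antipode_sum n x + fscale ((-1) ^ Suc n) (reduced_power (Suc n) x))"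

lemma flin_antipode_sum: "flin (antipode_sum n)"
  by (induction n) (auto intro!: flin_plus flin_fscale flin_conv_unit flin_conv
      simp del: power_Suc)

lemma reduced_power_conv_id: "conv (reduced_power n) id x = reduced_power n x + reduced_power (Suc n) x"
  unfolding id_eq_reduced conv_add_right
  by (simp only: conv_unit_right[OF flin_reduced_power] reduced_power_Suc_right)

lemma id_conv_reduced_power: "conv id (reduced_power n) x = reduced_power n x + reduced_power (Suc n) x"
  unfolding id_eq_reduced conv_add_left
  by (simp only: conv_unit_left[OF flin_reduced_power] reduced_power.simps)

text \<open>The sum telescopes: multiplying a power by \<open>id\<close> = \<open>conv_unit\<close>
  + \<open>reduced\<close> gives that power plus the next one, and the signs alternate. Only the
  last power survives as a remainder.\<close>

lemma antipode_sum_conv_id: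
  "conv (antipode_sum n) id x = conv_unit x + fscale ((-1) ^ n) (reduced_power (Suc n) x)"
proof (induction n)
  case 0
  show ?case using reduced_power_conv_id[of 0 x] by (simp add: id_def)
next
  case (Suc n)
  have "conv (antipode_sum (Suc n)) id x = conv (antipode_sum n) id x +
      fscale ((-1) ^ Suc n) (conv (reduced_power (Suc n)) id x)"
    by (simp only: antipode_sum.simps conv_add_left conv_scale_left)
  also have "\<dots> = conv_unit x + fscale ((-1) ^ Suc n) (reduced_power (Suc (Suc n)) x)"
    unfolding Suc reduced_power_conv_id by (simp add: fs.scale_right_distrib del: reduced_power.simps)
  finally show ?case .
qed

lemma id_conv_antipode_sum:
  "conv id (antipode_sum n) x = conv_unit x + fscale ((-1) ^ n) (reduced_power (Suc n) x)"
proof (induction n)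
  case 0
  show ?case using id_conv_reduced_power[of 0 x] by (simp add: id_def)
next
  case (Suc n)
  have "conv id (antipode_sum (Suc n)) x = conv id (antipode_sum n) x +
      fscale ((-1) ^ Suc n) (conv id (reduced_power (Suc n)) x)"
    by (simp only: antipode_sum.simps conv_add_right conv_scale_right)
  also have "\<dots> = conv_unit x + fscale ((-1) ^ Suc n) (reduced_power (Suc (Suc n)) x)"
    unfolding Suc id_conv_reduced_power by (simp add: fs.scale_right_distrib del: reduced_power.simps)
  finally show ?case .
qed

end

lemma tensor_map_cong:
  assumes "\<And>a b. (a, b) \<in> Poly_Mapping.keys z \<Longrightarrow> tensor (f (basis a)) (g (basis b)) = tensor (f' (basis a)) (g' (basis b))"
  shows "tensor_map f g z = tensor_map f' g' z"
  unfolding tensor_map_def lin_ext_def by (rule sum.cong) (use assms in auto)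

text \<open>\<open>deg_comult\<close> bounds the degrees of both tensor factors, which permits
  induction on degree; \<open>connected\<close> makes degree 0 basis vectors multiples of the unit,
  so that \<open>reduced\<close> kills them.\<close>

locale connected_bialgebra = bialgebra mult one comult counit
  for mult :: "('b \<Rightarrow>\<^sub>0 'k::field) \<Rightarrow> ('b \<Rightarrow>\<^sub>0 'k) \<Rightarrow> ('b \<Rightarrow>\<^sub>0 'k)" and one comult counit +
  fixes deg :: "'b \<Rightarrow> nat"
  assumes deg_comult: "(a, c) \<in> Poly_Mapping.keys (comult (basis b)) \<Longrightarrow> deg a + deg c \<le> deg b"
    and connected: "deg b = 0 \<Longrightarrow> basis b = fscale (counit (basis b)) one"
begin

text \<open>Every factor \<open>reduced\<close> uses up a degree: in a term of the coproduct either
  the left factor has degree 0 and is killed, or the right factor has degree below n and falls to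
  the induction hypothesis.\<close>

lemma reduced_power_vanish: "deg b < n \<Longrightarrow> reduced_power n (basis b) = 0"
proof (induction n arbitrary: b)
  case (Suc n)
  have "tensor (reduced (basis a)) (reduced_power n (basis c)) = 0"
    if "(a, c) \<in> Poly_Mapping.keys (comult (basis b))" for a c
  proof (cases "deg a = 0")
    case True
    then have "reduced (basis a) = 0"
      unfolding reduced_def conv_unit_def using connected[of a]
      by (metis True fs.scale_minus_left fs.scale_one add.right_inverse)
    then show ?thesis by (simp add: flin_zero[OF flin_tensor_left])
  next
    case False
    then have "deg c < n" using deg_comult[OF that] Suc.prems by linarith
    then show ?thesis by (simp add: Suc.IH flin_zero[OF flin_tensor_right])
  qed
  then have "tensor_map reduced (reduced_power n) (comult (basis b)) = 0"
    by (auto simp: tensor_map_def lin_ext_def intro!: sum.neutral)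
  then show ?case by (simp add: conv_def flin_zero[OF flin_mult_map])
qed simp

text \<open>On a basis vector the series is cut at its degree, beyond which all terms vanish; linear
  extension assembles these cuts into one map although no cut works for all degrees.\<close>

definition geometric_antipode :: "('b \<Rightarrow>\<^sub>0 'k) \<Rightarrow> ('b \<Rightarrow>\<^sub>0 'k)" where
  "geometric_antipode = lin_ext (\<lambda>b. antipode_sum (deg b) (basis b))"

lemma antipode_sum_stable: "deg b \<le> n \<Longrightarrow> antipode_sum n (basis b) = antipode_sum (deg b) (basis b)"
proof (induction n)
  case (Suc n)
  show ?case
  proof (cases "deg b = Suc n")
    case False
    then have "deg b \<le> n" using Suc.prems by simp
    then show ?thesis using Suc.IH reduced_power_vanish[of b "Suc n"]
      by (simp del: reduced_power.simps)
  qed simp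
qed simp

lemma geometric_antipode_basis: "deg b \<le> n \<Longrightarrow> geometric_antipode (basis b) = antipode_sum n (basis b)"
  unfolding geometric_antipode_def lin_ext_basis by (rule antipode_sum_stable[symmetric])

lemma flin_geometric_antipode: "flin geometric_antipode"
  unfolding geometric_antipode_def by (rule flin_lin_ext)

lemma is_antipode_geometric_antipode: "is_antipode mult one comult counit geometric_antipode"
proof -
  have left: "conv geometric_antipode id (basis b) = conv_unit (basis b)" for b
  proof -
    \<comment> \<open>The tensor factors occurring in the coproduct of \<open>basis b\<close> all
      have degree at most \<open>deg b\<close>, so a single partial sum computes the antipode on all
      of them; its remainder then vanishes at \<open>basis b\<close>.\<close>
    have "conv geometric_antipode id (basis b) = conv (antipode_sum (deg b)) id (basis b)"
      unfolding conv_def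
    proof (intro arg_cong[where f = "mult_map mult"] tensor_map_cong)
      fix a c assume ac: "(a, c) \<in> Poly_Mapping.keys (comult (basis b))"
      then have "deg a \<le> deg b" using deg_comult[OF ac] by linarith
      then have "geometric_antipode (basis a) = antipode_sum (deg b) (basis a)"
        by (rule geometric_antipode_basis)
      then show "tensor (geometric_antipode (basis a)) (id (basis c)) = tensor (antipode_sum (deg b) (basis a)) (id (basis c))"
        by simp
    qed
    then show ?thesis by (simp only: antipode_sum_conv_id reduced_power_vanish[OF lessI] fs.scale_zero_right add_0_right)
  qed
  have right: "conv id geometric_antipode (basis b) = conv_unit (basis b)" for b
  proof -
    have "conv id geometric_antipode (basis b) = conv id (antipode_sum (deg b)) (basis b)"
      unfolding conv_def
    proof (intro arg_cong[where f = "mult_map mult"] tensor_map_cong)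
      fix a c assume ac: "(a, c) \<in> Poly_Mapping.keys (comult (basis b))"
      then have "deg c \<le> deg b" using deg_comult[OF ac] by linarith
      then have "geometric_antipode (basis c) = antipode_sum (deg b) (basis c)"
        by (rule geometric_antipode_basis)
      then show "tensor (id (basis a)) (geometric_antipode (basis c)) = tensor (id (basis a)) (antipode_sum (deg b) (basis c))"
        by simp
    qed
    then show ?thesis by (simp only: id_conv_antipode_sum reduced_power_vanish[OF lessI] fs.scale_zero_right add_0_right)
  qed
  have "conv geometric_antipode id x = conv_unit x" "conv id geometric_antipode x = conv_unit x" for x
    by (rule flin_eqI[OF flin_conv flin_conv_unit left] flin_eqI[OF flin_conv flin_conv_unit right])+
  then show ?thesis
    unfolding is_antipode_iff fun_eq_iff using flin_geometric_antipode by blast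
qed

lemma the_antipode: "(THE S. is_antipode mult one comult counit S) = geometric_antipode"
  using is_antipode_geometric_antipode antipode_unique by blast

lemma hopf_algebra: "hopf_algebra mult one comult counit (THE S. is_antipode mult one comult counit S)"
  unfolding the_antipode
  by (rule hopf_algebra.intro) (rule mult_linear_left mult_linear_right mult_assoc one_mult mult_one comult_linear
      counit_linear comult_coassoc counit_left counit_right comult_mult comult_one counit_mult
      counit_one is_antipode_geometric_antipode)+

lemma hopf_subalgebra:
  assumes B: "fs.subspace B" and one: "one \<in> B"
    and m: "\<And>x y. x \<in> B \<Longrightarrow> y \<in> B \<Longrightarrow> mult x y \<in> B"
    and c: "\<And>x. x \<in> B \<Longrightarrow> comult x \<in> tensor_subspace B B"
  shows "hopf_subalgebra mult one comult counit (THE S. is_antipode mult one comult counit S) B"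
proof -
  have conv: "conv f g x \<in> B"
    if f: "flin f" and g: "flin g" and fB: "\<And>x. x \<in> B \<Longrightarrow> f x \<in> B"
      and gB: "\<And>x. x \<in> B \<Longrightarrow> g x \<in> B" and x: "x \<in> B" for f g x
    unfolding conv_def
  proof (rule flin_image_span[OF flin_comp[OF flin_mult_map flin_tensor_map]
        c[OF x, unfolded tensor_subspace_def] B])
    fix z assume "z \<in> {tensor a b |a b. a \<in> B \<and> b \<in> B}"
    then obtain a b where ab: "z = tensor a b" "a \<in> B" "b \<in> B" by blast
    have "mult (f a) (g b) \<in> B" using ab fB gB by (blast intro: m)
    then show "mult_map mult (tensor_map f g z) \<in> B"
      by (simp only: ab(1) tensor_map_tensor[OF f g] mult_map_tensor')
  qed
  have u: "x \<in> B \<Longrightarrow> conv_unit x \<in> B" for x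
    unfolding conv_unit_def using B one by (rule fs.subspace_scale)
  have r: "x \<in> B \<Longrightarrow> reduced x \<in> B" for x
    unfolding reduced_def by (intro fs.subspace_add[OF B] fs.subspace_scale[OF B] u)
  have p: "x \<in> B \<Longrightarrow> reduced_power n x \<in> B" for x n
  proof (induction n arbitrary: x)
    case (Suc n)
    then show ?case using conv[OF flin_reduced flin_reduced_power r] by simp
  qed (simp add: u)
  have s: "x \<in> B \<Longrightarrow> antipode_sum n x \<in> B" for x n
  proof (induction n)
    case (Suc n)
    show ?case unfolding antipode_sum.simps
      by (rule fs.subspace_add[OF B Suc.IH[OF Suc.prems] fs.subspace_scale[OF B p[OF Suc.prems]]])
  qed (simp add: u)
  have "geometric_antipode x \<in> B" if "x \<in> B" for x
  proof -
    \<comment> \<open>Partial sums preserve B, but the basis vectors of x need not lie in B. One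
      partial sum must therefore be valid on all of x, whence a common degree bound; the inserted 0
      covers x = 0.\<close>
    define n where "n = Max (insert 0 (deg ` Poly_Mapping.keys x))"
    have le: "deg b \<le> n" if "b \<in> Poly_Mapping.keys x" for b
      unfolding n_def using that by (intro Max_ge) auto
    have "geometric_antipode x = antipode_sum n x"
      by (rule flin_eq_on_keys[OF flin_geometric_antipode flin_antipode_sum geometric_antipode_basis[OF le]])
    then show ?thesis using s[OF that] by simp
  qed
  then show ?thesis
    using hopf_algebra assms unfolding hopf_subalgebra_def hopf_subalgebra_axioms_def the_antipode
    by blast
qed

end

section \<open>Standardization\<close>

lemma distinct_word_of [simp]: "distinct (word_of \<sigma>)"
  and set_word_of: "set (word_of \<sigma>) = {1..perm_size \<sigma>}"
  and length_word_of [simp]: "length (word_of \<sigma>) = perm_size \<sigma>"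
  using word_of[of \<sigma>] by (auto simp: perm_size_def)

lemma word_of_Perm_Word: "distinct w \<Longrightarrow> set w = {1..length w} \<Longrightarrow> word_of (Perm_Word w) = w"
  by (simp add: Perm_Word_inverse)

lemma perm_word_eqI: "word_of \<sigma> = word_of \<tau> \<Longrightarrow> \<sigma> = \<tau>"
  by (simp add: word_of_inject)

lemma word_of_Nil [simp]: "word_of (Perm_Word []) = []"
  by (rule word_of_Perm_Word) auto

lemma perm_size_Nil [simp]: "perm_size (Perm_Word []) = 0"
  by (simp add: perm_size_def)

lemma perm_size_eq_0_iff: "perm_size \<sigma> = 0 \<longleftrightarrow> \<sigma> = Perm_Word []"
  by (metis length_0_conv length_word_of perm_size_Nil perm_word_eqI word_of_Nil)

text \<open>Counting with \<open>\<le>\<close> makes ranks start at 1, so replacing letters by their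
  ranks standardizes a repetition-free word.\<close>

definition rank :: "'a::linorder set \<Rightarrow> 'a \<Rightarrow> nat" where
  "rank A x = card {y\<in>A. y \<le> x}"

lemma rank_mono: "finite A \<Longrightarrow> x \<le> y \<Longrightarrow> rank A x \<le> rank A y"
  unfolding rank_def by (rule card_mono) auto

lemma rank_strict_mono:
  assumes "finite A" "y \<in> A" "x < y"
  shows "rank A x < rank A y"
proof -
  have "{z\<in>A. z \<le> x} \<subseteq> {z\<in>A. z \<le> y}" "y \<in> {z\<in>A. z \<le> y}" "y \<notin> {z\<in>A. z \<le> x}"
    using assms by auto
  then show ?thesis unfolding rank_def using assms(1) by (intro psubset_card_mono) auto
qed

lemma rank_less_iff:
  assumes "finite A" "x \<in> A" "y \<in> A"
  shows "rank A x < rank A y \<longleftrightarrow> x < y"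
  using rank_mono[OF assms(1), of y x] rank_strict_mono[OF assms(1,3), of x] by (meson linorder_not_less)

lemma strict_mono_on_rank: "finite A \<Longrightarrow> strict_mono_on A (rank A)"
  by (auto intro!: strict_mono_onI simp: rank_less_iff)

lemma inj_on_rank: "finite A \<Longrightarrow> inj_on (rank A) A"
  by (intro strict_mono_on_imp_inj_on strict_mono_on_rank)

lemma rank_image_self:
  assumes "finite A"
  shows "rank A ` A = {1..card A}"
proof (rule card_subset_eq)
  show "rank A ` A \<subseteq> {1..card A}"
  proof (rule image_subsetI)
    fix x assume "x \<in> A"
    then have "card {y\<in>A. y \<le> x} > 0" using assms by (auto simp: card_gt_0_iff)
    moreover have "card {y\<in>A. y \<le> x} \<le> card A" using assms by (auto intro: card_mono)
    ultimately show "rank A x \<in> {1..card A}" by (simp add: rank_def)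
  qed
  show "card (rank A ` A) = card {1..card A}"
    by (simp add: card_image inj_on_rank assms)
qed simp

lemma rank_image:
  assumes "strict_mono_on A f" "x \<in> A"
  shows "rank (f ` A) (f x) = rank A x"
proof -
  have "{y \<in> f ` A. y \<le> f x} = f ` {y\<in>A. y \<le> x}"
    using assms strict_mono_on_leD[OF assms(1)] strict_mono_on_less_eq[OF assms(1)] by auto
  moreover have "inj_on f {y\<in>A. y \<le> x}"
    using strict_mono_on_imp_inj_on[OF assms(1)] by (rule inj_on_subset) auto
  ultimately show ?thesis by (simp add: rank_def card_image)
qed

lemma rank_interval: "x \<in> {1..n} \<Longrightarrow> rank {1..n} x = (x :: nat)"
proof -
  assume "x \<in> {1..n}"
  then have "{y\<in>{1..n}. y \<le> x} = {1..x}" by auto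
  then show ?thesis by (simp add: rank_def)
qed

lemma map_rank_perm: "map (rank (set (word_of \<sigma>))) (word_of \<sigma>) = word_of \<sigma>"
  by (rule map_idI) (simp add: set_word_of rank_interval del: One_nat_def)

text \<open>Counting positions instead of letters expresses ranks by comparisons between positions,
  which is what inversions record.\<close>

lemma rank_nth:
  assumes "distinct u" "i < length u"
  shows "rank (set u) (u ! i) = card {j. j < length u \<and> u ! j \<le> u ! i}"
proof -
  have "{y \<in> set u. y \<le> u ! i} = (!) u ` {j. j < length u \<and> u ! j \<le> u ! i}"
    by (auto simp: in_set_conv_nth)
  moreover have "inj_on ((!) u) {j. j < length u \<and> u ! j \<le> u ! i}"
    using assms(1) by (auto simp: inj_on_def nth_eq_iff_index_eq)
  ultimately show ?thesis by (simp add: rank_def card_image)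
qed

text \<open>Without ties, the inversions decide every comparison between two positions, in either
  order, and hence every rank.\<close>

lemma map_rank_eqI:
  assumes "distinct u" "distinct v" "length u = length v"
    and "\<And>i j. i < j \<Longrightarrow> j < length u \<Longrightarrow> u ! i > u ! j \<longleftrightarrow> v ! i > v ! j"
  shows "map (rank (set u)) u = map (rank (set v)) v"
proof (rule nth_equalityI)
  fix i assume "i < length (map (rank (set u)) u)"
  then have i: "i < length u" "i < length v" using assms by auto
  have "u ! j \<le> u ! i \<longleftrightarrow> v ! j \<le> v ! i" if "j < length u" for j
  proof (cases i j rule: linorder_cases)
    case less
    then have "u ! i \<noteq> u ! j" "v ! i \<noteq> v ! j" using assms that i by (auto simp: nth_eq_iff_index_eq)
    then show ?thesis using assms(4)[of i j] less that by (auto simp: le_less)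
  next
    case greater
    then show ?thesis using assms(4)[of j i] i by (auto simp: not_less[symmetric])
  qed simp
  then have "{j. j < length u \<and> u ! j \<le> u ! i} = {j. j < length v \<and> v ! j \<le> v ! i}"
    using assms(3) by auto
  then show "map (rank (set u)) u ! i = map (rank (set v)) v ! i"
    using i assms(1,2) by (simp add: rank_nth)
qed (use assms in auto)

text \<open>The rank word has the inversions of u because \<open>rank\<close> is strictly increasing
  on the letters. Any other candidate has the same rank word, and a permutation is its own rank
  word.\<close>

lemma word_of_std:
  assumes "distinct u"
  shows "word_of (std u) = map (rank (set u)) u"
proof -
  let ?w = "map (rank (set u)) u"
  have perm: "word_of (Perm_Word ?w) = ?w"
    by (rule word_of_Perm_Word)
      (use assms inj_on_rank[of "set u"] rank_image_self[of "set u"] in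
        \<open>auto simp: distinct_map distinct_card\<close>)
  have "std u = Perm_Word ?w"
    unfolding std_def
  proof (rule the_equality, intro conjI allI impI)
    show "perm_size (Perm_Word ?w) = length u" by (simp add: perm_size_def perm)
  next
    fix i j assume "i < j \<and> j < length u"
    then show "word_of (Perm_Word ?w) ! i > word_of (Perm_Word ?w) ! j \<longleftrightarrow> u ! i > u ! j"
      by (simp add: perm rank_less_iff)
  next
    fix \<sigma>
    assume "perm_size \<sigma> = length u \<and> (\<forall>i j. i < j \<and> j < length u \<longrightarrow>
      (word_of \<sigma> ! i > word_of \<sigma> ! j \<longleftrightarrow> u ! i > u ! j))"
    then have "map (rank (set (word_of \<sigma>))) (word_of \<sigma>) = ?w"
      by (intro map_rank_eqI assms) auto
    then show "\<sigma> = Perm_Word ?w"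
      by (intro perm_word_eqI) (simp add: perm map_rank_perm)
  qed
  then show ?thesis by (simp add: perm)
qed

lemma perm_size_std [simp]: "distinct u \<Longrightarrow> perm_size (std u) = length u"
  by (simp add: perm_size_def word_of_std)

lemma std_word_of [simp]: "std (word_of \<sigma>) = \<sigma>"
  by (intro perm_word_eqI) (simp add: word_of_std map_rank_perm)

lemma std_map:
  assumes "strict_mono_on (set u) f" "distinct u"
  shows "std (map f u) = std u"
proof (rule perm_word_eqI)
  have "distinct (map f u)"
    using assms strict_mono_on_imp_inj_on by (auto simp: distinct_map)
  then show "word_of (std (map f u)) = word_of (std u)"
    using assms by (simp add: word_of_std rank_image)
qed

lemma std_eq_iff:
  assumes "distinct u" "distinct v" "set u = set v"
  shows "std u = std v \<longleftrightarrow> u = v"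
proof
  assume "std u = std v"
  then have "map (rank (set u)) u = map (rank (set u)) v"
    using assms by (metis word_of_std)
  then show "u = v"
    using inj_on_rank[of "set u"] assms(3) by (auto intro: map_inj_on)
qed simp

lemma std_take: "distinct u \<Longrightarrow> std (take k (word_of (std u))) = std (take k u)"
  and std_drop: "distinct u \<Longrightarrow> std (drop k (word_of (std u))) = std (drop k u)"
  using monotone_on_subset[OF strict_mono_on_rank[of "set u"] set_take_subset[of k u]]
    monotone_on_subset[OF strict_mono_on_rank[of "set u"] set_drop_subset[of k u]]
  by (simp_all add: word_of_std take_map drop_map std_map)

section \<open>The bialgebra \<open>FQSym\<close>\<close>

definition perm_lo :: "nat \<Rightarrow> perm_word \<Rightarrow> perm_word" where
  "perm_lo k \<pi> = Perm_Word (filter (\<lambda>i. i \<le> k) (word_of \<pi>))"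

definition perm_hi :: "nat \<Rightarrow> perm_word \<Rightarrow> perm_word" where
  "perm_hi k \<pi> = Perm_Word (map (\<lambda>i. i - k) (filter (\<lambda>i. k < i) (word_of \<pi>)))"

lemma word_of_lo: "word_of (perm_lo k \<pi>) = filter (\<lambda>i. i \<le> k) (word_of \<pi>)" (is "_ = ?w")
proof -
  have d: "distinct ?w" by simp
  have "set ?w = {1..min k (perm_size \<pi>)}" by (auto simp: set_word_of)
  then have "set ?w = {1..length ?w}" using distinct_card[OF d] by simp
  then show ?thesis unfolding perm_lo_def by (intro word_of_Perm_Word d)
qed

lemma word_of_hi: "word_of (perm_hi k \<pi>) = map (\<lambda>i. i - k) (filter (\<lambda>i. k < i) (word_of \<pi>))" (is "_ = ?w")
proof -
  have d: "distinct ?w" unfolding distinct_map by (auto intro: inj_onI)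
  have s: "set (filter (\<lambda>i. k < i) (word_of \<pi>)) = {k+1..perm_size \<pi>}" by (auto simp: set_word_of)
  have w: "set ?w = {1..perm_size \<pi> - k}"
    unfolding set_map s
  proof (intro equalityI subsetI)
    fix i assume "i \<in> {1..perm_size \<pi> - k}"
    then show "i \<in> (\<lambda>i. i - k) ` {k + 1..perm_size \<pi>}" by (intro image_eqI[of _ _ "i + k"]) auto
  qed auto
  have "length ?w = perm_size \<pi> - k"
    using distinct_card[OF d] unfolding w by simp
  then have "set ?w = {1..length ?w}" using w by (simp only:)
  then show ?thesis unfolding perm_hi_def by (intro word_of_Perm_Word d)
qed

lemma perm_size_lo [simp]: "perm_size (perm_lo k \<pi>) = min k (perm_size \<pi>)"
proof -
  have "set (word_of (perm_lo k \<pi>)) = {1..min k (perm_size \<pi>)}"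
    by (auto simp: word_of_lo set_word_of)
  then have "card {1..perm_size (perm_lo k \<pi>)} = card {1..min k (perm_size \<pi>)}"
    by (simp only: set_word_of)
  then show ?thesis by simp
qed

lemma perm_size_hi [simp]: "perm_size (perm_hi k \<pi>) = perm_size \<pi> - k"
proof -
  have s: "set (filter (\<lambda>i. k < i) (word_of \<pi>)) = {k+1..perm_size \<pi>}" by (auto simp: set_word_of)
  have "length (filter (\<lambda>i. k < i) (word_of \<pi>)) = card {k+1..perm_size \<pi>}"
    unfolding s[symmetric] by (rule distinct_card[symmetric]) simp
  then show ?thesis using length_word_of[of "perm_hi k \<pi>"] unfolding word_of_hi by simp
qed

lemma lo_lo: "j \<le> k \<Longrightarrow> perm_lo j (perm_lo k \<pi>) = perm_lo j \<pi>"
  by (rule perm_word_eqI, simp only: word_of_lo filter_filter, rule filter_cong) auto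

lemma hi_hi: "perm_hi i (perm_hi j \<pi>) = perm_hi (i + j) \<pi>"
  by (rule perm_word_eqI, simp only: word_of_hi filter_map map_map filter_filter, rule map_cong, rule filter_cong) auto

text \<open>Both sides keep the values in (j, i + j] and shift them down by j: the middle block when
  the values are cut into three intervals.\<close>

lemma hi_lo: "perm_hi j (perm_lo (i + j) \<pi>) = perm_lo i (perm_hi j \<pi>)"
  by (rule perm_word_eqI, simp only: word_of_hi word_of_lo filter_map map_map filter_filter,
      rule map_cong, rule filter_cong) auto

lemma hi_0 [simp]: "perm_hi 0 \<pi> = \<pi>"
  by (intro perm_word_eqI) (simp add: word_of_hi set_word_of filter_True)

lemma lo_size [simp]: "perm_lo (perm_size \<pi>) \<pi> = \<pi>"
  by (intro perm_word_eqI) (simp add: word_of_lo set_word_of filter_True)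

text \<open>The alphabets are separated at k = \<open>perm_size \<sigma>\<close>, so filtering a
  shuffle at k recovers both words, and conversely a word is a shuffle of its two filtered
  parts.\<close>

lemma mem_shuffles_iff:
  "word_of \<pi> \<in> shuffles (word_of \<sigma>) (map (\<lambda>i. i + perm_size \<sigma>) (word_of \<nu>)) \<longleftrightarrow>
     perm_size \<sigma> \<le> perm_size \<pi> \<and> perm_lo (perm_size \<sigma>) \<pi> = \<sigma> \<and> perm_hi (perm_size \<sigma>) \<pi> = \<nu>"
  (is "?w \<in> shuffles ?s ?t \<longleftrightarrow> _")
proof
  let ?k = "perm_size \<sigma>"
  assume sh: "?w \<in> shuffles ?s ?t"
  have disj: "set ?s \<inter> set ?t = {}" by (auto simp: set_word_of)
  have "filter (\<lambda>i. i \<le> ?k) ?w = filter (\<lambda>i. i \<in> set ?s) ?w"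
    by (rule filter_cong) (auto simp: set_word_of)
  then have 1: "filter (\<lambda>i. i \<le> ?k) ?w = ?s"
    using filter_shuffles_disjoint1(1)[OF disj sh] by simp
  have "filter (\<lambda>i. ?k < i) ?w = filter (\<lambda>i. i \<notin> set ?s) ?w"
    by (rule filter_cong) (auto simp: set_word_of)
  then have 2: "filter (\<lambda>i. ?k < i) ?w = ?t"
    using filter_shuffles_disjoint1(2)[OF disj sh] by simp
  have "perm_lo ?k \<pi> = \<sigma>" by (intro perm_word_eqI) (simp add: word_of_lo 1)
  moreover have "perm_hi ?k \<pi> = \<nu>" by (intro perm_word_eqI) (simp add: word_of_hi 2 o_def)
  moreover have "?k \<le> perm_size \<pi>"
    using length_shuffles[OF sh] by simp
  ultimately show "?k \<le> perm_size \<pi> \<and> perm_lo ?k \<pi> = \<sigma> \<and> perm_hi ?k \<pi> = \<nu>" by simp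
next
  let ?k = "perm_size \<sigma>"
  assume *: "?k \<le> perm_size \<pi> \<and> perm_lo ?k \<pi> = \<sigma> \<and> perm_hi ?k \<pi> = \<nu>"
  have 1: "filter (\<lambda>i. i \<le> ?k) ?w = ?s"
    using word_of_lo[of ?k \<pi>] * by simp
  have "?t = map (\<lambda>i. i - ?k + ?k) (filter (\<lambda>i. ?k < i) ?w)"
    using word_of_hi[of ?k \<pi>] * by simp
  also have "\<dots> = filter (\<lambda>i. \<not> i \<le> ?k) ?w"
    unfolding not_le by (rule map_idI) auto
  finally have 2: "filter (\<lambda>i. \<not> i \<le> ?k) ?w = ?t" ..
  show "?w \<in> shuffles ?s ?t"
    using partition_in_shuffles[of ?w "\<lambda>i. i \<le> ?k"] unfolding 1 2 .
qed

lemma finite_perm_size: "finite {\<sigma>. perm_size \<sigma> = n}"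
proof -
  have "word_of ` {\<sigma>. perm_size \<sigma> = n} \<subseteq> {w. set w \<subseteq> {1..n} \<and> length w = n}"
    using set_word_of length_word_of by fastforce
  then have "finite (word_of ` {\<sigma>. perm_size \<sigma> = n})"
    by (rule finite_subset) (simp add: finite_lists_length_eq)
  then show ?thesis
    by (rule finite_imageD) (auto intro: inj_onI perm_word_eqI)
qed

lemma finite_shuffle_perms: "finite {\<pi>. word_of \<pi> \<in> shuffles u v}"
proof (rule finite_subset)
  show "{\<pi>. word_of \<pi> \<in> shuffles u v} \<subseteq> {\<pi>. perm_size \<pi> = length u + length v}"
    using length_shuffles length_word_of by fastforce
qed (rule finite_perm_size)

lemma flin_fq_mult_left: "flin (\<lambda>x. fq_mult x y)"
  and flin_fq_mult_right: "flin (fq_mult x)"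
  unfolding fq_mult_def by (rule flin_bilin_ext_left flin_bilin_ext_right)+

lemma fq_mult_basis:
  "fq_mult (F \<sigma>) (F \<nu>) =
     (\<Sum>\<pi> | word_of \<pi> \<in> shuffles (word_of \<sigma>) (map (\<lambda>i. i + perm_size \<sigma>) (word_of \<nu>)). F \<pi>)"
  by (simp add: fq_mult_def)

lemma lookup_sum_basis:
  "finite X \<Longrightarrow> Poly_Mapping.lookup (\<Sum>\<pi>\<in>X. basis \<pi>) \<tau> = (if \<tau> \<in> X then 1 else 0)"
  by (simp add: lookup_sum lookup_basis if_distrib cong: if_cong)

text \<open>The product transposed: for each k there is exactly one pair with first component of
  size k whose shifted shuffles contain \<pi>, namely its two restrictions.\<close>

lemma lookup_fq_mult:
  "Poly_Mapping.lookup (fq_mult x y) \<pi> =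
     (\<Sum>k\<le>perm_size \<pi>. Poly_Mapping.lookup x (perm_lo k \<pi>) * Poly_Mapping.lookup y (perm_hi k \<pi>))"
proof (rule functional_eqI[where x = x])
  fix \<sigma>
  show "Poly_Mapping.lookup (fq_mult (F \<sigma>) y) \<pi> =
     (\<Sum>k\<le>perm_size \<pi>. Poly_Mapping.lookup (F \<sigma>) (perm_lo k \<pi>) * Poly_Mapping.lookup y (perm_hi k \<pi>))"
  proof (rule functional_eqI[where x = y])
    fix \<nu>
    let ?f = "\<lambda>k. Poly_Mapping.lookup (F \<sigma>) (perm_lo k \<pi>) * Poly_Mapping.lookup (F \<nu>) (perm_hi k \<pi>) :: 'a"
    let ?c = "perm_size \<sigma> \<le> perm_size \<pi> \<and> perm_lo (perm_size \<sigma>) \<pi> = \<sigma> \<and> perm_hi (perm_size \<sigma>) \<pi> = \<nu>"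
    \<comment> \<open>For k up to the size of \<pi>, \<open>perm_lo k \<pi>\<close> has size k, so
      it can equal \<sigma> only when k is the size of \<sigma>.\<close>
    have "?f k = (if k = perm_size \<sigma> then if ?c then 1 else 0 else 0)" if "k \<le> perm_size \<pi>" for k
      using that by (auto simp: lookup_basis)
    then have "(\<Sum>k\<le>perm_size \<pi>. ?f k) = (\<Sum>k\<le>perm_size \<pi>. if k = perm_size \<sigma> then if ?c then 1 else 0 else 0)"
      by (intro sum.cong) auto
    also have "\<dots> = (if ?c then 1 else 0)" by (simp add: sum.delta)
    also have "\<dots> = (if \<pi> \<in> {\<pi>. word_of \<pi> \<in> shuffles (word_of \<sigma>)
        (map (\<lambda>i. i + perm_size \<sigma>) (word_of \<nu>))} then 1 else 0)"
      unfolding mem_Collect_eq mem_shuffles_iff ..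
    also have "\<dots> = Poly_Mapping.lookup (fq_mult (F \<sigma>) (F \<nu>)) \<pi>"
      unfolding fq_mult_basis by (rule lookup_sum_basis[OF finite_shuffle_perms, symmetric])
    finally show "Poly_Mapping.lookup (fq_mult (F \<sigma>) (F \<nu>)) \<pi> = (\<Sum>k\<le>perm_size \<pi>. ?f k)" ..
  qed (simp_all add: flin_add[OF flin_fq_mult_right] flin_scale[OF flin_fq_mult_right] lookup_add
      algebra_simps sum.distrib sum_distrib_left)
qed (simp_all add: flin_add[OF flin_fq_mult_left] flin_scale[OF flin_fq_mult_left] lookup_add
    algebra_simps sum.distrib sum_distrib_left)

text \<open>Two cuts j \<le> k are recorded by the first cut j and the distance i = k - j. This is
  the reindexing behind both associativity and coassociativity.\<close>

lemma sum_triangle_shift: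
  fixes g :: "nat \<Rightarrow> nat \<Rightarrow> 'a::comm_monoid_add"
  shows "(\<Sum>k\<le>n. \<Sum>j\<le>k. g j k) = (\<Sum>j\<le>n. \<Sum>i\<le>n - j. g j (i + j))"
proof -
  have "(\<Sum>k\<le>n. \<Sum>j\<le>k. g j k) = (\<Sum>(k, j)\<in>(SIGMA k:{..n}. {..k}). g j k)"
    by (rule sum.Sigma) auto
  also have "\<dots> = (\<Sum>(j, i)\<in>(SIGMA j:{..n}. {..n - j}). g j (i + j))"
    by (rule sum.reindex_bij_witness[where i = "\<lambda>(j, i). (i + j, j)" and j = "\<lambda>(k, j). (j, k - j)"]) auto
  also have "\<dots> = (\<Sum>j\<le>n. \<Sum>i\<le>n - j. g j (i + j))"
    by (rule sum.Sigma[symmetric]) auto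
  finally show ?thesis .
qed

text \<open>Both coefficients sum over the ways to cut the values of \<pi> into three consecutive
  intervals, choosing the upper cut first on the left and the lower cut first on the right.\<close>

lemma fq_mult_assoc: "fq_mult (fq_mult x y) z = fq_mult x (fq_mult y z)"
proof (rule poly_mapping_eqI)
  fix \<pi>
  let ?l = "Poly_Mapping.lookup"
  let ?g = "\<lambda>j k. ?l x (perm_lo j \<pi>) * ?l y (perm_hi j (perm_lo k \<pi>)) * ?l z (perm_hi k \<pi>)"
  have "?l (fq_mult (fq_mult x y) z) \<pi> = (\<Sum>k\<le>perm_size \<pi>. \<Sum>j\<le>k. ?g j k)"
    by (auto simp: lookup_fq_mult sum_distrib_right lo_lo intro!: sum.cong)
  also have "\<dots> = (\<Sum>j\<le>perm_size \<pi>. \<Sum>i\<le>perm_size \<pi> - j. ?g j (i + j))"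
    by (rule sum_triangle_shift)
  also have "\<dots> = ?l (fq_mult x (fq_mult y z)) \<pi>"
    by (simp add: lookup_fq_mult sum_distrib_left hi_lo hi_hi mult.assoc)
  finally show "?l (fq_mult (fq_mult x y) z) \<pi> = ?l (fq_mult x (fq_mult y z)) \<pi>" .
qed

lemma fq_one_mult: "fq_mult fq_one x = x"
proof (rule poly_mapping_eqI)
  fix \<pi>
  have "Poly_Mapping.lookup (fq_mult fq_one x) \<pi> =
    (\<Sum>k\<le>perm_size \<pi>. if k = 0 then Poly_Mapping.lookup x \<pi> else 0)"
    unfolding lookup_fq_mult fq_one_def
    by (intro sum.cong) (auto simp: lookup_basis perm_size_eq_0_iff[symmetric] eq_commute[of "Perm_Word []"])
  then show "Poly_Mapping.lookup (fq_mult fq_one x) \<pi> = Poly_Mapping.lookup x \<pi>" by simp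
qed

lemma fq_mult_one: "fq_mult x fq_one = x"
proof (rule poly_mapping_eqI)
  fix \<pi>
  have "Poly_Mapping.lookup (fq_mult x fq_one) \<pi> =
    (\<Sum>k\<le>perm_size \<pi>. if k = perm_size \<pi> then Poly_Mapping.lookup x \<pi> else 0)"
    unfolding lookup_fq_mult fq_one_def
    by (intro sum.cong) (auto simp: lookup_basis perm_size_eq_0_iff[symmetric] eq_commute[of "Perm_Word []"])
  then show "Poly_Mapping.lookup (fq_mult x fq_one) \<pi> = Poly_Mapping.lookup x \<pi>" by simp
qed

section \<open>Compatibility of the coproduct with the product\<close>

lemma rank_union_left:
  assumes "\<forall>a\<in>A. \<forall>b\<in>B. a < b" "x \<in> A"
  shows "rank (A \<union> B) x = rank A x"
proof -
  have "{y \<in> A \<union> B. y \<le> x} = {y \<in> A. y \<le> x}" using assms by force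
  then show ?thesis by (simp add: rank_def)
qed

lemma rank_union_right:
  assumes "finite A" "finite B" "\<forall>a\<in>A. \<forall>b\<in>B. a < b" "x \<in> B"
  shows "rank (A \<union> B) x = rank B x + card A"
proof -
  have "{y \<in> A \<union> B. y \<le> x} = {y \<in> B. y \<le> x} \<union> A" using assms by force
  moreover have "{y \<in> B. y \<le> x} \<inter> A = {}" using assms by force
  ultimately show ?thesis using assms by (simp add: rank_def card_Un_disjoint)
qed

lemma shuffles_map: "shuffles (map f xs) (map f ys) = map f ` shuffles xs ys"
  by (induction xs ys rule: shuffles.induct) (simp_all add: image_Un image_image)

text \<open>Ranking in the union of the alphabets turns x into \<open>std x\<close> and y into the
  shifted \<open>std y\<close>, because all of x lies below y. Products can thus be computed on
  prefixes and suffixes without first standardizing them.\<close>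

lemma fq_mult_std:
  assumes x: "distinct x" and y: "distinct y" and less: "\<forall>a\<in>set x. \<forall>b\<in>set y. a < b"
  shows "fq_mult (F (std x)) (F (std y)) = (\<Sum>u\<in>shuffles x y. F (std u))"
proof -
  define r where "r = rank (set x \<union> set y)"
  have sz: "perm_size (std x) = card (set x)" using x by (simp add: distinct_card)
  have wx: "word_of (std x) = map r x"
    by (simp add: word_of_std x r_def rank_union_left[OF less])
  have wy: "map (\<lambda>i. i + perm_size (std x)) (word_of (std y)) = map r y"
    by (simp add: word_of_std y sz r_def rank_union_right[OF _ _ less])
  have disj: "set x \<inter> set y = {}" using less by force
  have wu: "distinct u" "word_of (std u) = map r u" if "u \<in> shuffles x y" for u
    using distinct_disjoint_shuffles[OF x y disj that] set_shuffles[OF that]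
    by (auto simp: word_of_std r_def)
  have inj: "inj_on std (shuffles x y)"
  proof (rule inj_onI)
    fix u v assume uv: "u \<in> shuffles x y" "v \<in> shuffles x y" "std u = std v"
    then show "u = v" using wu set_shuffles std_eq_iff by metis
  qed
  have "{\<pi>. word_of \<pi> \<in> shuffles (map r x) (map r y)} = std ` shuffles x y"
  proof (intro equalityI subsetI)
    fix \<pi> assume "\<pi> \<in> {\<pi>. word_of \<pi> \<in> shuffles (map r x) (map r y)}"
    then obtain u where "u \<in> shuffles x y" "word_of \<pi> = map r u" by (auto simp: shuffles_map)
    then have "u \<in> shuffles x y" "\<pi> = std u" using wu by (auto intro: perm_word_eqI)
    then show "\<pi> \<in> std ` shuffles x y" by blast
  qed (auto simp: shuffles_map wu)
  then show ?thesis
    unfolding fq_mult_basis wx wy by (simp add: sum.reindex[OF inj])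
qed

lemma flin_fq_comult: "flin fq_comult"
  unfolding fq_comult_def by (rule flin_lin_ext)

lemma fq_comult_basis:
  "fq_comult (F \<sigma>) =
     (\<Sum>k\<le>perm_size \<sigma>. tensor (F (std (take k (word_of \<sigma>)))) (F (std (drop k (word_of \<sigma>)))))"
  by (simp add: fq_comult_def)

lemma fq_comult_std:
  "distinct u \<Longrightarrow> fq_comult (F (std u)) = (\<Sum>k\<le>length u. tensor (F (std (take k u))) (F (std (drop k u))))"
  by (simp add: fq_comult_basis std_take std_drop)

lemma shuffles_append:
  "u \<in> shuffles a b \<Longrightarrow> v \<in> shuffles c d \<Longrightarrow> u @ v \<in> shuffles (a @ c) (b @ d)"
proof (induction a b arbitrary: u rule: shuffles.induct)
  case (1 ys)
  then have "u = ys" by simp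
  moreover have "ys @ v \<in> shuffles c (ys @ d)"
    by (induction ys) (use 1 in \<open>auto intro: Cons_in_shuffles_rightI\<close>)
  ultimately show ?case by simp
next
  case (2 xs)
  then have "u = xs" by simp
  moreover have "xs @ v \<in> shuffles (xs @ c) d"
    by (induction xs) (use 2 in \<open>auto intro: Cons_in_shuffles_leftI\<close>)
  ultimately show ?case by simp
next
  case (3 x xs y ys)
  then show ?case by auto
qed

lemma filter_take_eq: "filter P (take k w) = take (length (filter P (take k w))) (filter P w)"
  by (metis append_eq_conv_conj append_take_drop_id filter_append)

lemma filter_drop_eq: "filter P (drop k w) = drop (length (filter P (take k w))) (filter P w)"
  by (metis append_eq_conv_conj append_take_drop_id filter_append)

text \<open>Cutting a shuffle cuts both shuffled words: i and j count the letters of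
  \<open>xs\<close> and \<open>ys\<close> in the prefix, recoverable because the alphabets are
  disjoint. In the other direction, a shuffle of prefixes followed by a shuffle of suffixes is a
  shuffle.\<close>

lemma sum_shuffles_split:
  assumes disj: "set xs \<inter> set ys = {}"
  shows "(\<Sum>w\<in>shuffles xs ys. \<Sum>k\<le>length w. G (take k w) (drop k w)) =
    (\<Sum>i\<le>length xs. \<Sum>j\<le>length ys. \<Sum>u\<in>shuffles (take i xs) (take j ys).
      \<Sum>v\<in>shuffles (drop i xs) (drop j ys). G u v)"
proof -
  let ?P = "\<lambda>z. z \<in> set xs"
  let ?A = "SIGMA w:shuffles xs ys. {..length w}"
  let ?B = "SIGMA i:{..length xs}. SIGMA j:{..length ys}.
      SIGMA u:shuffles (take i xs) (take j ys). shuffles (drop i xs) (drop j ys)"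
  let ?c = "\<lambda>w k. length (filter ?P (take k w))"
  let ?d = "\<lambda>w k. length (filter (\<lambda>z. \<not> ?P z) (take k w))"
  have "(\<Sum>w\<in>shuffles xs ys. \<Sum>k\<le>length w. G (take k w) (drop k w)) =
      (\<Sum>(w, k)\<in>?A. G (take k w) (drop k w))"
    by (rule sum.Sigma) auto
  also have "\<dots> = (\<Sum>(i, j, u, v)\<in>?B. G u v)"
  proof (rule sum.reindex_bij_witness[where i = "\<lambda>(i, j, u, v). (u @ v, length u)"
        and j = "\<lambda>(w, k). (?c w k, ?d w k, take k w, drop k w)"])
    fix a assume "a \<in> ?A"
    then obtain w k where a: "a = (w, k)" "w \<in> shuffles xs ys" "k \<le> length w" by auto
    note f = filter_shuffles_disjoint1[OF disj a(2)]
    have "take k w \<in> shuffles (take (?c w k) xs) (take (?d w k) ys)"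
      using partition_in_shuffles[of "take k w" ?P] filter_take_eq[of ?P k w]
        filter_take_eq[of "\<lambda>z. \<not> ?P z" k w] by (simp add: f)
    moreover have "drop k w \<in> shuffles (drop (?c w k) xs) (drop (?d w k) ys)"
      using partition_in_shuffles[of "drop k w" ?P] filter_drop_eq[of ?P k w]
        filter_drop_eq[of "\<lambda>z. \<not> ?P z" k w] by (simp add: f)
    moreover have "?c w k \<le> length xs" "?d w k \<le> length ys"
      using arg_cong[OF filter_take_eq[of ?P k w], of length]
        arg_cong[OF filter_take_eq[of "\<lambda>z. \<not> ?P z" k w], of length] by (simp_all add: f)
    ultimately show "(case a of (w, k) \<Rightarrow> (?c w k, ?d w k, take k w, drop k w)) \<in> ?B"
      by (simp add: a(1))
    show "(case (case a of (w, k) \<Rightarrow> (?c w k, ?d w k, take k w, drop k w)) of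
        (i, j, u, v) \<Rightarrow> (u @ v, length u)) = a"
      by (simp add: a)
    show "(case (case a of (w, k) \<Rightarrow> (?c w k, ?d w k, take k w, drop k w)) of
        (i, j, u, v) \<Rightarrow> G u v) = (case a of (w, k) \<Rightarrow> G (take k w) (drop k w))"
      by (simp add: a)
  next
    fix b assume "b \<in> ?B"
    then obtain i j u v where b: "b = (i, j, u, v)" "i \<le> length xs" "j \<le> length ys"
      "u \<in> shuffles (take i xs) (take j ys)" "v \<in> shuffles (drop i xs) (drop j ys)" by auto
    have "u @ v \<in> shuffles xs ys"
      using shuffles_append[OF b(4,5)] by simp
    then show "(case b of (i, j, u, v) \<Rightarrow> (u @ v, length u)) \<in> ?A"
      by (simp add: b(1))
    have u: "set u = set (take i xs) \<union> set (take j ys)" by (rule set_shuffles[OF b(4)])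
    have sub: "set (take i xs) \<subseteq> set xs" "set (take j ys) \<subseteq> set ys" by (rule set_take_subset)+
    have d': "set (take i xs) \<inter> set (take j ys) = {}" using sub disj by blast
    have "filter ?P u = filter (\<lambda>z. z \<in> set (take i xs)) u"
      by (rule filter_cong) (use u sub disj in auto)
    then have 1: "filter ?P u = take i xs" using filter_shuffles_disjoint1(1)[OF d' b(4)] by simp
    have "filter (\<lambda>z. \<not> ?P z) u = filter (\<lambda>z. z \<notin> set (take i xs)) u"
      by (rule filter_cong) (use u sub disj in auto)
    then have 2: "filter (\<lambda>z. \<not> ?P z) u = take j ys" using filter_shuffles_disjoint1(2)[OF d' b(4)] by simp
    show "(case (case b of (i, j, u, v) \<Rightarrow> (u @ v, length u)) of
        (w, k) \<Rightarrow> (?c w k, ?d w k, take k w, drop k w)) = b"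
      using b(2,3) by (simp add: b(1) 1 2)
  qed
  also have "\<dots> = (\<Sum>i\<le>length xs. \<Sum>j\<le>length ys. \<Sum>u\<in>shuffles (take i xs) (take j ys).
      \<Sum>v\<in>shuffles (drop i xs) (drop j ys). G u v)"
    by (simp add: sum.Sigma finite_SigmaI)
  finally show ?thesis .
qed

lemma tensor_sum_sum:
  "tensor (\<Sum>a\<in>A. f a) (\<Sum>b\<in>B. g b) = (\<Sum>a\<in>A. \<Sum>b\<in>B. tensor (f a) (g b))"
  by (simp add: flin_sum[OF flin_tensor_left] flin_sum[OF flin_tensor_right], rule sum.swap)

lemma fq_comult_mult:
  fixes x y :: "'k::field fqsym"
  shows "fq_comult (fq_mult x y) = tensor_mult fq_mult (fq_comult x) (fq_comult y)"
proof (rule bilin_eqI[where x = x and y = y])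
  fix \<sigma> \<nu>
  define xs where "xs = word_of \<sigma>"
  \<comment> \<open>The second factor is represented on the shifted alphabet, so shuffling and
    cutting act on actual words and \<open>std\<close> is only applied to the resulting
    pieces.\<close>
  define ys where "ys = map (\<lambda>i. i + perm_size \<sigma>) (word_of \<nu>)"
  have dx: "distinct xs" and dy: "distinct ys" by (simp_all add: xs_def ys_def distinct_map inj_on_def)
  have less: "\<forall>a\<in>set xs. \<forall>b\<in>set ys. a < b" by (auto simp: xs_def ys_def set_word_of)
  then have disj: "set xs \<inter> set ys = {}" by force
  have sx: "std xs = \<sigma>" by (simp add: xs_def)
  have mono: "strict_mono_on A (\<lambda>i. i + perm_size \<sigma>)" for A by (auto intro: strict_mono_onI)
  have sy: "std ys = \<nu>" by (simp add: ys_def std_map mono)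
  have mult: "fq_mult (F (std (take i xs))) (F (std (take j ys))) = (\<Sum>u\<in>shuffles (take i xs) (take j ys). F (std u))"
    "fq_mult (F (std (drop i xs))) (F (std (drop j ys))) = (\<Sum>u\<in>shuffles (drop i xs) (drop j ys). F (std u))"
    for i j
    using less by (auto intro!: fq_mult_std simp: dx dy dest: in_set_takeD in_set_dropD)
  have "fq_comult (fq_mult (F \<sigma>) (F \<nu>)) = (\<Sum>w\<in>shuffles xs ys. fq_comult (F (std w)))"
    unfolding fq_mult_std[OF dx dy less, unfolded sx sy] by (rule flin_sum[OF flin_fq_comult])
  also have "\<dots> = (\<Sum>w\<in>shuffles xs ys. \<Sum>k\<le>length w. tensor (F (std (take k w))) (F (std (drop k w))))"
    by (intro sum.cong refl fq_comult_std distinct_disjoint_shuffles[OF dx dy disj])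
  also have "\<dots> = (\<Sum>i\<le>length xs. \<Sum>j\<le>length ys. \<Sum>u\<in>shuffles (take i xs) (take j ys).
      \<Sum>v\<in>shuffles (drop i xs) (drop j ys). tensor (F (std u)) (F (std v)))"
    by (rule sum_shuffles_split[OF disj])
  also have "\<dots> = (\<Sum>i\<le>length xs. \<Sum>j\<le>length ys.
      tensor (fq_mult (F (std (take i xs))) (F (std (take j ys)))) (fq_mult (F (std (drop i xs))) (F (std (drop j ys)))))"
    by (simp only: mult tensor_sum_sum)
  also have "\<dots> = tensor_mult fq_mult (fq_comult (F (std xs))) (fq_comult (F (std ys)))"
    unfolding fq_comult_std[OF dx] fq_comult_std[OF dy]
    by (simp only: flin_sum[OF flin_tensor_mult_left] flin_sum[OF flin_tensor_mult_right]
        tensor_mult_tensor[OF flin_fq_mult_left flin_fq_mult_right], rule sum.swap)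
  finally show "fq_comult (fq_mult (F \<sigma>) (F \<nu>)) = tensor_mult fq_mult (fq_comult (F \<sigma>)) (fq_comult (F \<nu>))"
    unfolding sx sy .
qed (intro flin_comp[OF flin_fq_comult] flin_comp[OF flin_tensor_mult_left] flin_comp[OF flin_tensor_mult_right]
    flin_fq_comult flin_fq_mult_left flin_fq_mult_right)+

section \<open>Coassociativity, counit and connectedness\<close>

lemma fq_comult_coassoc:
  "tensor_assoc (tensor_map fq_comult id (fq_comult x)) = tensor_map id fq_comult (fq_comult x)"
proof (rule flin_eqI[where x = x])
  fix \<sigma>
  let ?w = "word_of \<sigma>" and ?n = "perm_size \<sigma>"
  let ?T = "\<lambda>a b c. tensor (F (std a)) (tensor (F (std b)) (F (std c)))"
  \<comment> \<open>Factorizations into three words: here k is the outer cut and j cuts the prefix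
    again; after the shift j is the outer cut and i cuts the suffix.\<close>
  have "tensor_assoc (tensor_map fq_comult id (fq_comult (F \<sigma>))) =
      (\<Sum>k\<le>?n. \<Sum>j\<le>k. ?T (take j ?w) (drop j (take k ?w)) (drop k ?w))"
    by (auto simp: fq_comult_basis flin_sum[OF flin_tensor_map] flin_sum[OF flin_tensor_assoc]
        tensor_map_tensor[OF flin_fq_comult flin_id'] fq_comult_std flin_sum[OF flin_tensor_left] tensor_assoc_tensor
        std_take std_drop simp del: tensor_basis intro!: sum.cong)
  also have "\<dots> = (\<Sum>j\<le>?n. \<Sum>i\<le>?n - j. ?T (take j ?w) (drop j (take (i + j) ?w)) (drop (i + j) ?w))"
    by (rule sum_triangle_shift)
  also have "\<dots> = tensor_map id fq_comult (fq_comult (F \<sigma>))"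
    by (simp add: fq_comult_basis flin_sum[OF flin_tensor_map] tensor_map_tensor[OF flin_id' flin_fq_comult]
        fq_comult_std flin_sum[OF flin_tensor_right] drop_take
        std_take std_drop del: tensor_basis)
  finally show "tensor_assoc (tensor_map fq_comult id (fq_comult (F \<sigma>))) =
      tensor_map id fq_comult (fq_comult (F \<sigma>))" .
qed (intro flin_comp[OF flin_tensor_assoc] flin_comp[OF flin_tensor_map] flin_fq_comult)+

lemma fq_counit_basis: "fq_counit (F \<sigma>) = (if perm_size \<sigma> = 0 then 1 else 0)"
  by (simp add: fq_counit_def lookup_basis perm_size_eq_0_iff)

lemma fscale_of_bool: "fscale (if P then 1 else 0) x = (if P then x else 0)"
  by simp

lemma fq_counit_left: "lin_ext (\<lambda>(a, b). fscale (fq_counit (basis a)) (basis b)) (fq_comult x) = x"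
proof (rule flin_eqI[where x = x])
  fix \<sigma>
  show "lin_ext (\<lambda>(a, b). fscale (fq_counit (basis a)) (basis b)) (fq_comult (F \<sigma>)) = F \<sigma>"
    by (simp add: fq_comult_basis flin_sum[OF flin_lin_ext] fq_counit_basis fscale_of_bool)
qed (intro flin_comp[OF flin_lin_ext] flin_fq_comult flin_id)+

lemma fq_counit_right: "lin_ext (\<lambda>(a, b). fscale (fq_counit (basis b)) (basis a)) (fq_comult x) = x"
proof (rule flin_eqI[where x = x])
  fix \<sigma>
  show "lin_ext (\<lambda>(a, b). fscale (fq_counit (basis b)) (basis a)) (fq_comult (F \<sigma>)) = F \<sigma>"
    by (simp add: fq_comult_basis flin_sum[OF flin_lin_ext] fq_counit_basis fscale_of_bool)
qed (intro flin_comp[OF flin_lin_ext] flin_fq_comult flin_id)+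

lemma fq_connected_bialgebra:
  "connected_bialgebra (fq_mult :: 'k::field fqsym \<Rightarrow> _) fq_one fq_comult fq_counit perm_size"
proof (intro connected_bialgebra.intro connected_bialgebra_axioms.intro bialgebra.intro)
  have "vector_space ((*) :: 'k \<Rightarrow> 'k \<Rightarrow> 'k)"
    by unfold_locales (auto simp: algebra_simps)
  then show "Vector_Spaces.linear fscale (*) (fq_counit :: 'k fqsym \<Rightarrow> 'k)"
    by (auto simp: Vector_Spaces.linear_iff vector_space_fscale fq_counit_def lookup_add)
next
  fix x y :: "'k fqsym"
  have "perm_lo 0 (Perm_Word []) = Perm_Word []"
    using lo_size[of "Perm_Word []"] by simp
  then show "fq_counit (fq_mult x y) = fq_counit x * fq_counit y"
    by (simp add: fq_counit_def lookup_fq_mult)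
next
  show "fq_comult (fq_one :: 'k fqsym) = tensor fq_one fq_one"
    using std_word_of[of "Perm_Word []"] by (simp add: fq_one_def fq_comult_basis)
next
  show "fq_counit (fq_one :: 'k fqsym) = 1" by (simp add: fq_one_def fq_counit_basis)
next
  fix a b c :: perm_word
  assume "(a, c) \<in> Poly_Mapping.keys (fq_comult (F b :: 'k fqsym))"
  then have "(a, c) \<in> (\<Union>k\<le>perm_size b. {(std (take k (word_of b)), std (drop k (word_of b)))})"
    unfolding fq_comult_basis using keys_sum by fastforce
  then show "perm_size a + perm_size c \<le> perm_size b" by auto
next
  fix b :: perm_word
  assume "perm_size b = 0"
  then show "F b = fscale (fq_counit (F b)) (fq_one :: 'k fqsym)"
    by (simp add: fq_counit_basis fq_one_def perm_size_eq_0_iff)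
qed (rule flin_fq_mult_left flin_fq_mult_right flin_fq_comult
    fq_mult_assoc fq_one_mult fq_mult_one fq_comult_coassoc fq_counit_left fq_counit_right fq_comult_mult)+

section \<open>Binary search trees of words\<close>

definition bst_of :: "'a::linorder list \<Rightarrow> 'a tree" where
  "bst_of w = fold bst_insert w Leaf"

text \<open>Letters on different sides of the root never meet, so insertion splits into two
  independent insertions that keep their relative order.\<close>

lemma fold_bst_insert_Node:
  "fold bst_insert w (Node l a r) =
     Node (fold bst_insert (filter (\<lambda>y. y < a) w) l) a (fold bst_insert (filter (\<lambda>y. \<not> y < a) w) r)"
  by (induction w arbitrary: l r) auto

lemma bst_of_Nil [simp]: "bst_of [] = Leaf"
  by (simp add: bst_of_def)

lemma bst_of_Cons:
  "bst_of (x # w) = Node (bst_of (filter (\<lambda>y. y < x) w)) x (bst_of (filter (\<lambda>y. \<not> y < x) w))"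
  by (simp add: bst_of_def fold_bst_insert_Node)

lemma bst_of_append: "bst_of (u @ v) = fold bst_insert v (bst_of u)"
  by (simp add: bst_of_def)

lemma set_tree_bst_insert [simp]: "set_tree (bst_insert x t) = insert x (set_tree t)"
  by (induction t) auto

lemma set_tree_fold: "set_tree (fold bst_insert w t) = set w \<union> set_tree t"
  by (induction w arbitrary: t) auto

lemma set_tree_bst_of [simp]: "set_tree (bst_of w) = set w"
  by (simp add: bst_of_def set_tree_fold)

lemma size_bst_insert [simp]: "size (bst_insert x t) = Suc (size t)"
  by (induction t) auto

lemma size_bst_of [simp]: "size (bst_of w) = length w"
proof -
  have "size (fold bst_insert w t) = length w + size t" for t
    by (induction w arbitrary: t) auto
  then show ?thesis by (simp add: bst_of_def)
qed

lemma bst_bst_insert: "bst t \<Longrightarrow> x \<notin> set_tree t \<Longrightarrow> bst (bst_insert x t)"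
  by (induction t) auto

lemma bst_bst_of:
  assumes "distinct w"
  shows "bst (bst_of w)"
proof -
  have "bst t \<Longrightarrow> set_tree t \<inter> set w = {} \<Longrightarrow> bst (fold bst_insert w t)" for t
    using assms by (induction w arbitrary: t) (auto simp: bst_bst_insert)
  then show ?thesis by (simp add: bst_of_def)
qed

text \<open>The inorder reading depends on the letters alone, so all the information about the order
  of the word sits in the shape.\<close>

lemma inorder_bst_of:
  assumes "distinct w"
  shows "inorder (bst_of w) = sorted_list_of_set (set w)"
  using bst_bst_of[OF assms, unfolded bst_iff_sorted_wrt_less]
  by (intro strict_sorted_equal) auto

section \<open>Pruning search trees, and dependence on labels\<close>

primrec tree_below :: "'a::linorder \<Rightarrow> 'a tree \<Rightarrow> 'a tree" where
  "tree_below a Leaf = Leaf"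
| "tree_below a (Node l x r) = (if x < a then Node l x (tree_below a r) else tree_below a l)"

primrec tree_above :: "'a::linorder \<Rightarrow> 'a tree \<Rightarrow> 'a tree" where
  "tree_above a Leaf = Leaf"
| "tree_above a (Node l x r) = (if x < a then tree_above a r else Node (tree_above a l) x r)"

text \<open>When the root is at least a, pruning discards it with its right subtree; an inserted
  letter below a goes left there, hence never into a discarded part. Pruning thus commutes with
  single insertions, and so with inserting a word.\<close>

lemma tree_below_insert:
  "tree_below a (bst_insert y t) = (if y < a then bst_insert y (tree_below a t) else tree_below a t)"
  by (induction t) auto

lemma tree_above_insert:
  "tree_above a (bst_insert y t) = (if y < a then tree_above a t else bst_insert y (tree_above a t))"
  by (induction t) auto

lemma bst_of_filter_less: "bst_of (filter (\<lambda>y. y < a) w) = tree_below a (bst_of w)"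
proof -
  have "tree_below a (fold bst_insert w t) = fold bst_insert (filter (\<lambda>y. y < a) w) (tree_below a t)" for t
    by (induction w arbitrary: t) (auto simp: tree_below_insert)
  from this[of Leaf] show ?thesis by (simp add: bst_of_def)
qed

lemma bst_of_filter_not_less: "bst_of (filter (\<lambda>y. \<not> y < a) w) = tree_above a (bst_of w)"
proof -
  have "tree_above a (fold bst_insert w t) = fold bst_insert (filter (\<lambda>y. \<not> y < a) w) (tree_above a t)" for t
    by (induction w arbitrary: t) (auto simp: tree_above_insert)
  from this[of Leaf] show ?thesis by (simp add: bst_of_def)
qed

text \<open>
  Below a leaf of \<open>t\<close> the letters of an interval are inserted, and they create the search
  tree of a restriction of \<open>w\<close>, which the search tree of \<open>w\<close> determines.
\<close>

lemma fold_bst_insert_cong: "bst_of w = bst_of w' \<Longrightarrow> fold bst_insert w t = fold bst_insert w' t"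
proof (induction t arbitrary: w w')
  case Leaf
  then show ?case by (simp add: bst_of_def)
next
  case (Node l a r)
  have "bst_of (filter (\<lambda>y. y < a) w) = bst_of (filter (\<lambda>y. y < a) w')"
    "bst_of (filter (\<lambda>y. \<not> y < a) w) = bst_of (filter (\<lambda>y. \<not> y < a) w')"
    unfolding bst_of_filter_less bst_of_filter_not_less Node.prems by simp_all
  from Node.IH(1)[OF this(1)] Node.IH(2)[OF this(2)] show ?case
    by (simp only: fold_bst_insert_Node)
qed

lemma bst_of_append_cong: "bst_of u = bst_of u' \<Longrightarrow> bst_of v = bst_of v' \<Longrightarrow> bst_of (u @ v) = bst_of (u' @ v')"
  unfolding bst_of_append by (metis fold_bst_insert_cong)

text \<open>Insertion only compares letters, so an increasing relabelling of the word relabels the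
  tree. Induction stays inside the letters of w, where f is known to be increasing.\<close>

lemma bst_of_map:
  assumes "strict_mono_on (set w) f"
  shows "bst_of (map f w) = map_tree f (bst_of w)"
proof -
  have ins: "map_tree f (bst_insert x t) = bst_insert (f x) (map_tree f t)"
    if "x \<in> set w" "set_tree t \<subseteq> set w" for x t
    using that by (induction t) (auto simp: strict_mono_on_less[OF assms])
  have "map_tree f (fold bst_insert v t) = fold bst_insert (map f v) (map_tree f t)"
    if "set v \<subseteq> set w" "set_tree t \<subseteq> set w" for v t
    using that by (induction v arbitrary: t) (auto simp: ins)
  from this[of w Leaf] show ?thesis by (simp add: bst_of_def)
qed

lemma size_shape_of [simp]: "size (shape_of t) = size t"
  by (simp add: shape_of_def)

text \<open>The shape gives the size of the left subtree, and this tells where the inorder list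
  splits around the root.\<close>

lemma shape_inorder_eqI: "shape_of s = shape_of t \<Longrightarrow> inorder s = inorder t \<Longrightarrow> s = t"
proof (induction s arbitrary: t)
  case Leaf
  then show ?case by (cases t) (auto simp: shape_of_def)
next
  case (Node l a r)
  then obtain l' a' r' where t: "t = Node l' a' r'" by (cases t) (auto simp: shape_of_def)
  have "shape_of l = shape_of l'" "shape_of r = shape_of r'"
    using Node.prems(1) by (auto simp: t shape_of_def)
  moreover from this(1) have "length (inorder l) = length (inorder l')"
    by (metis length_inorder size_shape_of)
  ultimately show ?case using Node by (auto simp: t)
qed

subsection \<open>Canopies\<close>

text \<open>For a permutation and consecutive values i, i + 1 this fails exactly at the descents of
  the inverse permutation, which the canopy records.\<close>

fun before :: "'a list \<Rightarrow> 'a \<Rightarrow> 'a \<Rightarrow> bool" where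
  "before [] a b \<longleftrightarrow> False"
| "before (x # w) a b \<longleftrightarrow> (if x = a then b \<in> set w else before w a b)"

lemma before_filter: "P a \<Longrightarrow> P b \<Longrightarrow> before (filter P w) a b = before w a b"
  by (induction w) auto

lemma before_mem: "before w a b \<Longrightarrow> b \<in> set w"
  by (induction w) (auto split: if_splits)

lemma before_append:
  "before (u @ v) a b \<longleftrightarrow> (if a \<in> set u then before u a b \<or> b \<in> set v else before v a b)"
  by (induction u) auto

lemma before_rev:
  "distinct w \<Longrightarrow> a \<in> set w \<Longrightarrow> b \<in> set w \<Longrightarrow> a \<noteq> b \<Longrightarrow> before (rev w) a b \<longleftrightarrow> \<not> before w a b"
proof (induction w)
  case (Cons x w)
  then show ?case using before_mem[of w a b] by (auto simp: before_append)
qed simp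

text \<open>Applied to an inorder list, this has one entry for each leaf other than the first and
  the last, since inner leaves sit between consecutive nodes.\<close>

fun gaps :: "('a \<Rightarrow> 'a \<Rightarrow> 'b) \<Rightarrow> 'a list \<Rightarrow> 'b list" where
  "gaps f (x # y # zs) = f x y # gaps f (y # zs)"
| "gaps f _ = []"

lemma gaps_Cons: "gaps f (x # r) = (if r = [] then [] else f x (hd r) # gaps f r)"
  by (cases r) auto

lemma gaps_append:
  "gaps f (l @ x # r) = (if l = [] then [] else gaps f l @ [f (last l) x]) @ gaps f (x # r)"
proof (induction l)
  case (Cons a l)
  then show ?case by (cases l) (auto simp: gaps_Cons)
qed simp

lemma gaps_cong: "(\<And>a b. a \<in> set s \<Longrightarrow> b \<in> set s \<Longrightarrow> f a b = g a b) \<Longrightarrow> gaps f s = gaps g s"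
  by (induction f s rule: gaps.induct) auto

lemma nth_gaps: "Suc i < length s \<Longrightarrow> gaps f s ! i = f (s ! i) (s ! Suc i)"
proof (induction s arbitrary: i)
  case (Cons x s)
  then show ?case by (cases i; cases s) auto
qed simp

text \<open>Of two inorder neighbours a, b the one inserted first is an ancestor of the other. If it
  is a, then b is leftmost in the right subtree of a and the leaf between them is its left child,
  entry 1; otherwise it is the right child of a, entry 0. The outer 1 and 0 are the extreme leaves.
  Induction is on length because the subtrees come from filtered words.\<close>

lemma leaf_word_bst_of:
  "distinct w \<Longrightarrow> leaf_word d (bst_of w) =
    (if w = [] then [d] else 1 # gaps (\<lambda>a b. if before w a b then 1 else 0) (inorder (bst_of w)) @ [0])"
proof (induction w arbitrary: d rule: length_induct)
  case (1 w)
  show ?case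
  proof (cases w)
    case (Cons x v)
    let ?f = "\<lambda>w a b. if before w a b then 1 else (0::nat)"
    define L where "L = filter (\<lambda>y. y < x) v"
    define R where "R = filter (\<lambda>y. \<not> y < x) v"
    have dist: "distinct v" "x \<notin> set v" "distinct L" "distinct R"
      using "1.prems" by (auto simp: Cons L_def R_def)
    have len: "length L < length w" "length R < length w"
      by (simp_all add: Cons L_def R_def le_imp_less_Suc)
    have L: "leaf_word 1 (bst_of L) = (if L = [] then [1] else 1 # gaps (?f L) (inorder (bst_of L)) @ [0])"
      using "1.IH" dist(3) len(1) by blast
    have R: "leaf_word 0 (bst_of R) = (if R = [] then [0] else 1 # gaps (?f R) (inorder (bst_of R)) @ [0])"
      using "1.IH" dist(4) len(2) by blast
    have gL: "gaps (?f L) (inorder (bst_of L)) = gaps (?f w) (inorder (bst_of L))"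
      by (rule gaps_cong) (use dist(2) in \<open>auto simp: Cons L_def before_filter\<close>)
    have gR: "gaps (?f R) (inorder (bst_of R)) = gaps (?f w) (inorder (bst_of R))"
      by (rule gaps_cong) (use dist(2) in \<open>auto simp: Cons R_def before_filter\<close>)
    have empty: "bst_of u = Leaf \<longleftrightarrow> u = []" for u :: "'a list"
      by (metis length_0_conv size_bst_of eq_size_0)
    \<comment> \<open>The root is the first letter of w, so it does not follow its left neighbour
      and it precedes its right neighbour.\<close>
    have last: "?f w (last (inorder (bst_of L))) x = 0" if "L \<noteq> []"
    proof -
      have "last (inorder (bst_of L)) \<in> set (inorder (bst_of L))" using that by (intro last_in_set) (simp add: empty)
      then have "last (inorder (bst_of L)) \<noteq> x" using dist(2) by (auto simp: L_def)
      then show ?thesis using dist(2) before_mem[of v _ x] by (auto simp: Cons)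
    qed
    have hd: "?f w x (hd (inorder (bst_of R))) = 1" if "R \<noteq> []"
    proof -
      have "hd (inorder (bst_of R)) \<in> set (inorder (bst_of R))" using that by (intro hd_in_set) (simp add: empty)
      then show ?thesis by (auto simp: Cons R_def)
    qed
    have "bst_of w = Node (bst_of L) x (bst_of R)"
      by (simp only: Cons bst_of_Cons L_def R_def)
    moreover have "w \<noteq> []" by (simp add: Cons)
    ultimately show ?thesis
      using last hd by (auto simp: L R gL gR gaps_append gaps_Cons[of _ x] empty simp del: One_nat_def)
  qed simp
qed

lemma canopy_shape_of: "canopy (shape_of t) = canopy t"
proof -
  have "leaf_word d (shape_of t) = leaf_word d t" for d
    by (induction t arbitrary: d) (auto simp: shape_of_def)
  then show ?thesis by (simp add: canopy_def)
qed

lemma canopy_bst_of: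
  assumes "distinct w" "w \<noteq> []"
  shows "canopy (bst_of w) = gaps (\<lambda>a b. if before w a b then 1 else 0) (sorted_list_of_set (set w))"
  using assms by (simp add: canopy_def leaf_word_bst_of inorder_bst_of)

lemma P_symbol_eq: "P_symbol \<sigma> = (shape_of (bst_of (word_of \<sigma>)), shape_of (bst_of (rev (word_of \<sigma>))))"
  by (simp add: P_symbol_def bst_of_def)

text \<open>Reversing the word exchanges the relative order of every two letters, so every canopy
  entry flips.\<close>

lemma twin_P_symbol: "twin (P_symbol \<sigma>)"
proof -
  let ?w = "word_of \<sigma>"
  let ?s = "sorted_list_of_set (set ?w)"
  have "canopy (bst_of ?w) ! i \<noteq> canopy (bst_of (rev ?w)) ! i" if i: "i < perm_size \<sigma> - 1" for i
  proof -
    have len: "length ?s = perm_size \<sigma>" by (simp add: set_word_of)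
    have "?w \<noteq> []" using i by (metis length_0_conv length_word_of less_nat_zero_code zero_diff)
    then have "canopy (bst_of ?w) ! i = (if before ?w (?s ! i) (?s ! Suc i) then 1 else 0)"
      "canopy (bst_of (rev ?w)) ! i = (if before (rev ?w) (?s ! i) (?s ! Suc i) then 1 else 0)"
      using i len canopy_bst_of[of ?w] canopy_bst_of[of "rev ?w"] by (simp_all add: nth_gaps)
    moreover have "?s ! i \<in> set ?w" "?s ! Suc i \<in> set ?w"
      using i len nth_mem[of i ?s] nth_mem[of "Suc i" ?s] by auto
    moreover have "?s ! i \<noteq> ?s ! Suc i" using i len by (simp add: nth_eq_iff_index_eq)
    ultimately show ?thesis by (simp add: before_rev)
  qed
  then show ?thesis by (simp add: twin_def P_symbol_eq canopy_shape_of)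
qed

section \<open>The Baxter subalgebra\<close>

lemma perm_size_eq_size_P_symbol: "perm_size \<sigma> = size (fst (P_symbol \<sigma>))"
  by (simp add: P_symbol_eq)

text \<open>Equal shapes have equal size, hence the same letters 1..n and the same inorder lists;
  the forgotten labels are thereby recovered. Pruning, which looks at labels, becomes applicable to
  \<open>P_symbol\<close>.\<close>

lemma P_symbol_eq_iff:
  "P_symbol \<sigma> = P_symbol \<tau> \<longleftrightarrow>
     bst_of (word_of \<sigma>) = bst_of (word_of \<tau>) \<and> bst_of (rev (word_of \<sigma>)) = bst_of (rev (word_of \<tau>))"
  (is "?l \<longleftrightarrow> ?r")
proof
  assume ?l
  then have "perm_size \<sigma> = perm_size \<tau>" by (simp add: perm_size_eq_size_P_symbol)
  then have "set (word_of \<sigma>) = set (word_of \<tau>)" by (simp add: set_word_of)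
  then show ?r
    using \<open>?l\<close> by (auto simp: P_symbol_eq inorder_bst_of intro: shape_inorder_eqI)
qed (simp add: P_symbol_eq)

lemma P_symbol_perm_size: "P_symbol \<sigma> = P_symbol \<tau> \<Longrightarrow> perm_size \<sigma> = perm_size \<tau>"
  by (simp add: perm_size_eq_size_P_symbol)

lemma P_symbol_lo:
  assumes "P_symbol \<pi> = P_symbol \<pi>'"
  shows "P_symbol (perm_lo k \<pi>) = P_symbol (perm_lo k \<pi>')"
proof -
  \<comment> \<open>\<open>tree_below\<close> cuts with a strict inequality, hence the bound
    \<open>Suc k\<close>.\<close>
  have "word_of (perm_lo k \<rho>) = filter (\<lambda>i. i < Suc k) (word_of \<rho>)" for \<rho>
    by (simp add: word_of_lo less_Suc_eq_le)
  then show ?thesis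
    using assms by (simp add: P_symbol_eq_iff bst_of_filter_less rev_filter)
qed

lemma P_symbol_hi:
  assumes "P_symbol \<pi> = P_symbol \<pi>'"
  shows "P_symbol (perm_hi k \<pi>) = P_symbol (perm_hi k \<pi>')"
proof -
  have bst: "bst_of (map (\<lambda>i. i - k) (filter (\<lambda>i. k < i) w)) =
      map_tree (\<lambda>i. i - k) (tree_above (Suc k) (bst_of w))" for w
  proof -
    \<comment> \<open>Truncated subtraction is not injective below k; it is increasing on the
      letters that are kept.\<close>
    have "strict_mono_on (set (filter (\<lambda>i. k < i) w)) (\<lambda>i. i - k)"
      by (auto intro!: strict_mono_onI)
    moreover have "filter (\<lambda>i. k < i) w = filter (\<lambda>i. \<not> i < Suc k) w"
      by (simp add: not_less Suc_le_eq)
    ultimately show ?thesis by (metis bst_of_map bst_of_filter_not_less)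
  qed
  show ?thesis
    using assms unfolding P_symbol_eq_iff word_of_hi rev_map rev_filter bst by simp
qed

section \<open>Words with prescribed letters and standardization, and the coproduct\<close>

text \<open>The word with set of letters \<open>A\<close> and standardization \<open>\<mu>\<close>.\<close>

definition relabel :: "nat set \<Rightarrow> perm_word \<Rightarrow> nat list" where
  "relabel A \<mu> = map (\<lambda>i. sorted_list_of_set A ! (i - 1)) (word_of \<mu>)"

text \<open>Letters of a permutation start at 1 and list positions at 0, hence \<open>i - 1\<close>;
  monotonicity is confined to {1..card A} because 0 and 1 share a position.\<close>

lemma strict_mono_on_relabel:
  assumes "finite A"
  shows "strict_mono_on {1..card A} (\<lambda>i. sorted_list_of_set A ! (i - 1))"
proof (rule strict_mono_onI)
  fix i j assume "i \<in> {1..card A}" "j \<in> {1..card A}" "i < j"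
  then show "sorted_list_of_set A ! (i - 1) < sorted_list_of_set A ! (j - 1)"
    using assms by (intro sorted_wrt_nth_less[OF strict_sorted_list_of_set]) auto
qed

lemma set_relabel:
  assumes "finite A" "card A = perm_size \<mu>"
  shows "set (relabel A \<mu>) = A"
proof -
  have "(\<lambda>i. sorted_list_of_set A ! (i - 1)) ` {1..card A} = (!) (sorted_list_of_set A) ` {0..<card A}"
  proof (intro equalityI subsetI)
    fix x assume "x \<in> (!) (sorted_list_of_set A) ` {0..<card A}"
    then obtain i where "i < card A" "x = sorted_list_of_set A ! i" by auto
    then show "x \<in> (\<lambda>i. sorted_list_of_set A ! (i - 1)) ` {1..card A}"
      by (intro image_eqI[of _ _ "Suc i"]) auto
  qed auto
  also have "\<dots> = A"
    using nth_image[of "card A" "sorted_list_of_set A"] assms(1) by (simp add: atLeast0LessThan lessThan_def)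
  finally show ?thesis using assms(2) by (simp add: relabel_def set_word_of del: One_nat_def)
qed

lemma length_relabel [simp]: "length (relabel A \<mu>) = perm_size \<mu>"
  by (simp add: relabel_def)

lemma distinct_relabel:
  assumes "finite A" "card A = perm_size \<mu>"
  shows "distinct (relabel A \<mu>)"
  by (rule card_distinct) (simp add: set_relabel assms)

lemma std_relabel:
  assumes "finite A" "card A = perm_size \<mu>"
  shows "std (relabel A \<mu>) = \<mu>"
  using std_map[of "word_of \<mu>"] strict_mono_on_relabel[OF assms(1)] assms(2)
  by (simp add: relabel_def set_word_of del: One_nat_def)

text \<open>The standardization and the set of letters together determine a repetition-free
  word.\<close>

lemma relabel_std:
  assumes "distinct u"
  shows "relabel (set u) (std u) = u"
proof -
  have "card (set u) = perm_size (std u)" using assms by (simp add: distinct_card)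
  then have "std (relabel (set u) (std u)) = std u" "distinct (relabel (set u) (std u))"
    "set (relabel (set u) (std u)) = set u"
    by (simp_all add: std_relabel distinct_relabel set_relabel)
  then show ?thesis using std_eq_iff assms by blast
qed

lemma bst_of_relabel:
  assumes "finite A" "card A = perm_size \<mu>"
  shows "bst_of (relabel A \<mu>) = map_tree (\<lambda>i. sorted_list_of_set A ! (i - 1)) (bst_of (word_of \<mu>))"
    and "bst_of (rev (relabel A \<mu>)) = map_tree (\<lambda>i. sorted_list_of_set A ! (i - 1)) (bst_of (rev (word_of \<mu>)))"
  using strict_mono_on_relabel[OF assms(1)] assms(2)
  by (simp_all add: relabel_def rev_map bst_of_map set_word_of del: One_nat_def)

text \<open>The terms of the product dual to deconcatenation: A chooses the letters of the first
  factor and its complement those of the second.\<close>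

definition join :: "nat set \<Rightarrow> perm_word \<Rightarrow> perm_word \<Rightarrow> perm_word" where
  "join A \<mu> \<nu> = Perm_Word (relabel A \<mu> @ relabel ({1..perm_size \<mu> + perm_size \<nu>} - A) \<nu>)"

lemma
  assumes "A \<subseteq> {1..perm_size \<mu> + perm_size \<nu>}" "card A = perm_size \<mu>"
  shows finite_split: "finite A" "finite ({1..perm_size \<mu> + perm_size \<nu>} - A)"
    and card_split: "card ({1..perm_size \<mu> + perm_size \<nu>} - A) = perm_size \<nu>"
proof -
  show "finite A" using assms(1) by (rule finite_subset) simp
  then show "card ({1..perm_size \<mu> + perm_size \<nu>} - A) = perm_size \<nu>"
    using assms by (simp add: card_Diff_subset)
qed simp

lemma word_of_join:
  assumes "A \<subseteq> {1..perm_size \<mu> + perm_size \<nu>}" "card A = perm_size \<mu>"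
  shows "word_of (join A \<mu> \<nu>) = relabel A \<mu> @ relabel ({1..perm_size \<mu> + perm_size \<nu>} - A) \<nu>"
  unfolding join_def
proof (rule word_of_Perm_Word)
  note * = finite_split[OF assms] card_split[OF assms]
  show "distinct (relabel A \<mu> @ relabel ({1..perm_size \<mu> + perm_size \<nu>} - A) \<nu>)"
    using * assms by (auto simp: distinct_relabel set_relabel simp del: One_nat_def)
  show "set (relabel A \<mu> @ relabel ({1..perm_size \<mu> + perm_size \<nu>} - A) \<nu>) =
    {1..length (relabel A \<mu> @ relabel ({1..perm_size \<mu> + perm_size \<nu>} - A) \<nu>)}"
    using * assms by (auto simp: set_relabel simp del: One_nat_def)
qed

text \<open>For a fixed A, relabelling acts on search trees node by node, and the tree of a
  concatenation is determined by those of its factors. For the right-to-left tree the factors appear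
  in the opposite order.\<close>

lemma P_symbol_join:
  assumes A: "A \<subseteq> {1..perm_size \<mu> + perm_size \<nu>}" "card A = perm_size \<mu>"
    and \<mu>: "P_symbol \<mu> = P_symbol \<mu>'" and \<nu>: "P_symbol \<nu> = P_symbol \<nu>'"
  shows "P_symbol (join A \<mu> \<nu>) = P_symbol (join A \<mu>' \<nu>')"
proof -
  let ?B = "{1..perm_size \<mu> + perm_size \<nu>} - A"
  have sz: "perm_size \<mu>' = perm_size \<mu>" "perm_size \<nu>' = perm_size \<nu>"
    using \<mu> \<nu> by (auto dest: P_symbol_perm_size)
  have w: "word_of (join A \<mu> \<nu>) = relabel A \<mu> @ relabel ?B \<nu>"
    "word_of (join A \<mu>' \<nu>') = relabel A \<mu>' @ relabel ?B \<nu>'"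
    using word_of_join[OF A] word_of_join[of A \<mu>' \<nu>'] A sz by simp_all
  note fin = finite_split[OF A] and card = A(2) card_split[OF A]
  have "bst_of (relabel A \<mu>) = bst_of (relabel A \<mu>')"
    "bst_of (rev (relabel A \<mu>)) = bst_of (rev (relabel A \<mu>'))"
    "bst_of (relabel ?B \<nu>) = bst_of (relabel ?B \<nu>')"
    "bst_of (rev (relabel ?B \<nu>)) = bst_of (rev (relabel ?B \<nu>'))"
    using \<mu> \<nu> fin card sz by (simp_all add: bst_of_relabel P_symbol_eq_iff del: One_nat_def)
  then show ?thesis
    unfolding P_symbol_eq_iff w rev_append by (auto intro: bst_of_append_cong)
qed

text \<open>Once cut after \<open>perm_size \<mu>\<close> letters, a permutation is determined by
  the standardizations of its two parts and the set of letters of the first.\<close>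

lemma join_eq_iff:
  assumes A: "A \<subseteq> {1..perm_size \<mu> + perm_size \<nu>}" "card A = perm_size \<mu>"
  shows "join A \<mu> \<nu> = \<sigma> \<longleftrightarrow> perm_size \<mu> \<le> perm_size \<sigma> \<and> std (take (perm_size \<mu>) (word_of \<sigma>)) = \<mu> \<and>
    std (drop (perm_size \<mu>) (word_of \<sigma>)) = \<nu> \<and> A = set (take (perm_size \<mu>) (word_of \<sigma>))"
    (is "_ \<longleftrightarrow> ?c")
proof
  let ?B = "{1..perm_size \<mu> + perm_size \<nu>} - A"
  note fin = finite_split[OF A] and card = A(2) card_split[OF A]
  {
    assume "join A \<mu> \<nu> = \<sigma>"
    then have w: "word_of \<sigma> = relabel A \<mu> @ relabel ?B \<nu>" using word_of_join[OF A] by simp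
    then have "perm_size \<sigma> = perm_size \<mu> + perm_size \<nu>" by (metis length_append length_relabel length_word_of)
    then show ?c
      using fin card unfolding w by (simp add: std_relabel set_relabel del: One_nat_def)
  next
    assume c: ?c
    define k where "k = perm_size \<mu>"
    let ?w = "word_of \<sigma>"
    have "perm_size \<nu> = length (drop k ?w)" using c unfolding k_def
      by (metis distinct_drop distinct_word_of perm_size_std)
    then have n: "perm_size \<mu> + perm_size \<nu> = perm_size \<sigma>" using c by (simp add: k_def)
    have disj: "set (take k ?w) \<inter> set (drop k ?w) = {}"
      by (rule set_take_disj_set_drop_if_distinct) simp_all
    have "set ?w = set (take k ?w) \<union> set (drop k ?w)"
      by (metis append_take_drop_id set_append)
    then have B: "?B = set (drop k ?w)"
      unfolding n using disj c by (auto simp: set_word_of[symmetric] k_def simp del: One_nat_def)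
    have "relabel A \<mu> = take k ?w"
      using relabel_std[of "take k ?w"] c by (simp add: k_def)
    moreover have "relabel ?B \<nu> = drop k ?w"
      unfolding B using relabel_std[of "drop k ?w"] c by (simp add: k_def)
    ultimately show "join A \<mu> \<nu> = \<sigma>"
      by (intro perm_word_eqI) (simp only: word_of_join[OF A] append_take_drop_id)
  }
qed

lemma sum_indicator:
  assumes "finite S" "c \<Longrightarrow> a \<in> S"
  shows "(\<Sum>x\<in>S. if c \<and> x = a then 1 else 0) = (if c then 1 else 0)"
  using assms by (cases c) simp_all

text \<open>The coproduct transposed. For a given \<sigma>, at most one cut yields the pair (\<mu>,
  \<nu>), and exactly one set A then recovers \<sigma> as a join.\<close>

lemma lookup_fq_comult:
  "Poly_Mapping.lookup (fq_comult x) (\<mu>, \<nu>) =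
     (\<Sum>A | A \<subseteq> {1..perm_size \<mu> + perm_size \<nu>} \<and> card A = perm_size \<mu>. Poly_Mapping.lookup x (join A \<mu> \<nu>))"
    (is "_ = sum _ ?S")
proof (rule functional_eqI[where x = x])
  fix \<sigma>
  let ?w = "word_of \<sigma>" and ?k = "perm_size \<mu>"
  let ?c = "?k \<le> perm_size \<sigma> \<and> std (take ?k ?w) = \<mu> \<and> std (drop ?k ?w) = \<nu>"
  let ?A = "set (take ?k ?w)"
  have fin: "finite ?S" by simp
  have A: "?A \<in> ?S" if ?c
  proof -
    have "?A \<subseteq> set ?w" by (rule set_take_subset)
    moreover have "perm_size \<nu> = length (drop ?k ?w)"
      using that by (metis distinct_drop distinct_word_of perm_size_std)
    moreover have "card ?A = ?k" using that by (simp add: distinct_card)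
    ultimately show ?thesis using that by (simp add: set_word_of)
  qed
  have R: "(\<Sum>A\<in>?S. if ?c \<and> A = ?A then 1 else 0) = (if ?c then 1 else 0 :: 'a)"
    by (rule sum_indicator[OF fin A])
  have "Poly_Mapping.lookup (fq_comult (F \<sigma>)) (\<mu>, \<nu>) =
      (\<Sum>k\<le>perm_size \<sigma>. if k = ?k then if ?c then 1 else 0 else 0 :: 'a)"
    unfolding fq_comult_basis tensor_basis lookup_sum
  proof (intro sum.cong refl)
    fix k assume "k \<in> {..perm_size \<sigma>}"
    then have k: "k \<le> perm_size \<sigma>" by simp
    then have "perm_size (std (take k ?w)) = k" by simp
    \<comment> \<open>A prefix of length k standardizes to a permutation of size k, so only the cut
      at \<open>perm_size \<mu>\<close> contributes.\<close>
    then have "std (take k ?w) = \<mu> \<and> std (drop k ?w) = \<nu> \<longleftrightarrow> k = ?k \<and> ?c"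
      using k by metis
    then show "Poly_Mapping.lookup (basis (std (take k ?w), std (drop k ?w))) (\<mu>, \<nu>) =
        (if k = ?k then if ?c then 1 else 0 else 0 :: 'a)"
      unfolding lookup_basis prod.inject by argo
  qed
  also have "\<dots> = (if ?c then 1 else 0)" by simp
  also have "\<dots> = (\<Sum>A\<in>?S. Poly_Mapping.lookup (F \<sigma>) (join A \<mu> \<nu>))"
    unfolding R[symmetric]
  proof (intro sum.cong refl)
    fix A assume "A \<in> ?S"
    then have "join A \<mu> \<nu> = \<sigma> \<longleftrightarrow> ?c \<and> A = ?A"
      unfolding mem_Collect_eq conj_assoc by (elim conjE) (rule join_eq_iff)
    then show "(if ?c \<and> A = ?A then 1 else 0) = (Poly_Mapping.lookup (F \<sigma>) (join A \<mu> \<nu>) :: 'a)"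
      by (simp only: lookup_basis eq_commute[of \<sigma>])
  qed
  finally show "Poly_Mapping.lookup (fq_comult (F \<sigma>)) (\<mu>, \<nu>) =
      (\<Sum>A\<in>?S. Poly_Mapping.lookup (F \<sigma>) (join A \<mu> \<nu>) :: 'a)" .
qed (simp_all add: flin_add[OF flin_fq_comult] flin_scale[OF flin_fq_comult] lookup_add sum.distrib sum_distrib_left)

section \<open>The span of the fibre sums as a space of class functions\<close>

lemma finite_P_symbol: "finite {\<sigma>. P_symbol \<sigma> = J}"
  by (rule finite_subset[OF _ finite_perm_size[of "size (fst J)"]]) (auto simp: perm_size_eq_size_P_symbol)

lemma lookup_baxter_P: "Poly_Mapping.lookup (baxter_P J) \<sigma> = (if P_symbol \<sigma> = J then 1 else 0)"
  unfolding baxter_P_def lookup_sum_basis[OF finite_P_symbol] by simp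

lemma baxter_P_symbol_in_span: "baxter_P (P_symbol \<sigma>) \<in> fs.span {baxter_P J | J. twin J}"
  by (rule fs.span_base) (use twin_P_symbol in blast)

text \<open>The generators are indicator functions of disjoint fibres. An element constant on fibres
  has finite support, so it combines finitely many of them; \<open>twin_P_symbol\<close> ensures
  that these are generators.\<close>

lemma span_baxter_P:
  "fs.span {baxter_P J | J. twin J} =
     {x :: 'k::field fqsym. \<forall>\<sigma> \<tau>. P_symbol \<sigma> = P_symbol \<tau> \<longrightarrow> Poly_Mapping.lookup x \<sigma> = Poly_Mapping.lookup x \<tau>}"
    (is "_ = ?B")
proof (rule antisym)
  have "fs.subspace ?B"
  proof (rule fs.subspaceI)
    fix x y :: "'k fqsym" and c assume "x \<in> ?B" "y \<in> ?B"
    then show "x + y \<in> ?B" unfolding mem_Collect_eq lookup_add by metis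
  next
    fix x :: "'k fqsym" and c assume "x \<in> ?B"
    then show "fscale c x \<in> ?B" unfolding mem_Collect_eq lookup_fscale by metis
  qed simp
  then show "fs.span {baxter_P J | J. twin J} \<subseteq> ?B"
    by (intro fs.span_minimal) (auto simp: lookup_baxter_P)
  show "?B \<subseteq> fs.span {baxter_P J | J. twin J}"
  proof
    fix x assume x: "x \<in> ?B"
    let ?K = "P_symbol ` Poly_Mapping.keys x"
    \<comment> \<open>The value on the fibre is read off at an arbitrary representative. It is used
      where the fibre is nonempty, and constancy makes the choice harmless.\<close>
    define c where "c J = Poly_Mapping.lookup x (SOME \<sigma>. P_symbol \<sigma> = J)" for J
    have c: "c (P_symbol \<sigma>) = Poly_Mapping.lookup x \<sigma>" for \<sigma>
    proof -
      have "P_symbol (SOME \<tau>. P_symbol \<tau> = P_symbol \<sigma>) = P_symbol \<sigma>" by (rule someI) (rule refl)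
      then show ?thesis using x unfolding c_def by blast
    qed
    have "x = (\<Sum>J\<in>?K. fscale (c J) (baxter_P J))"
    proof (rule poly_mapping_eqI)
      fix \<sigma>
      have "Poly_Mapping.lookup (\<Sum>J\<in>?K. fscale (c J) (baxter_P J)) \<sigma> =
          (\<Sum>J\<in>?K. if P_symbol \<sigma> = J then c J else 0)"
        unfolding lookup_sum by (intro sum.cong) (auto simp: lookup_baxter_P)
      also have "\<dots> = Poly_Mapping.lookup x \<sigma>"
        by (auto simp: c in_keys_iff)
      finally show "Poly_Mapping.lookup x \<sigma> = Poly_Mapping.lookup (\<Sum>J\<in>?K. fscale (c J) (baxter_P J)) \<sigma>" ..
    qed
    also have "\<dots> \<in> fs.span {baxter_P J | J. twin J}"
      by (intro fs.span_sum fs.span_scale) (elim imageE, simp only: baxter_P_symbol_in_span)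
    finally show "x \<in> fs.span {baxter_P J | J. twin J}" .
  qed
qed

text \<open>The expansion into fibre sums again, now for the map P \<times> P: the indicator of a
  product of two fibres is the pure tensor of their sums. It reduces closure under the coproduct to
  a comparison of coefficients.\<close>

lemma tensor_subspace_baxter_P:
  fixes z :: "perm_word \<times> perm_word \<Rightarrow>\<^sub>0 'k::field"
  assumes z: "\<And>\<mu> \<mu>' \<nu> \<nu>'. P_symbol \<mu> = P_symbol \<mu>' \<Longrightarrow> P_symbol \<nu> = P_symbol \<nu>' \<Longrightarrow>
    Poly_Mapping.lookup z (\<mu>, \<nu>) = Poly_Mapping.lookup z (\<mu>', \<nu>')"
  shows "z \<in> tensor_subspace (fs.span {baxter_P J | J. twin J}) (fs.span {baxter_P J | J. twin J})"
proof -
  let ?V = "fs.span {baxter_P J | J. twin J} :: 'k fqsym set"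
  let ?P = "map_prod P_symbol P_symbol"
  let ?K = "?P ` Poly_Mapping.keys z"
  let ?T = "\<lambda>J. tensor (baxter_P (fst J)) (baxter_P (snd J)) :: _ \<Rightarrow>\<^sub>0 'k"
  define c where "c J = Poly_Mapping.lookup z (SOME p. ?P p = J)" for J
  have c: "c (?P p) = Poly_Mapping.lookup z p" for p
  proof -
    have "?P (SOME q. ?P q = ?P p) = ?P p" by (rule someI) (rule refl)
    moreover have "Poly_Mapping.lookup z q = Poly_Mapping.lookup z p" if "?P q = ?P p" for q
      using z[of "fst q" "fst p" "snd q" "snd p"] that by (cases p, cases q) simp
    ultimately show ?thesis unfolding c_def by blast
  qed
  have "z = (\<Sum>J\<in>?K. fscale (c J) (?T J))"
  proof (rule poly_mapping_eqI)
    fix p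
    have "Poly_Mapping.lookup (\<Sum>J\<in>?K. fscale (c J) (?T J)) p = (\<Sum>J\<in>?K. if ?P p = J then c J else 0)"
      unfolding lookup_sum by (intro sum.cong refl, cases p) (auto simp: lookup_tensor lookup_baxter_P)
    also have "\<dots> = Poly_Mapping.lookup z p"
      by (auto simp: c in_keys_iff simp del: map_prod_simp)
    finally show "Poly_Mapping.lookup z p = Poly_Mapping.lookup (\<Sum>J\<in>?K. fscale (c J) (?T J)) p" ..
  qed
  also have "\<dots> \<in> tensor_subspace ?V ?V"
  proof -
    have "?T J \<in> tensor_subspace ?V ?V" if "J \<in> ?K" for J
      using that by (elim imageE)
        (simp only: fst_map_prod snd_map_prod baxter_P_symbol_in_span tensor_in_tensor_subspace)
    then show ?thesis
      unfolding tensor_subspace_def by (intro fs.span_sum fs.span_scale) auto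
  qed
  finally show ?thesis .
qed

theorem theorem6p2:
  shows "hopf_subalgebra fq_mult fq_one fq_comult fq_counit fq_antipode
           (module.span fscale {baxter_P J | J. twin J} :: 'k::field_char_0 fqsym set)"
proof -
  let ?V = "fs.span {baxter_P J | J. twin J} :: 'k fqsym set"
  have V: "x \<in> ?V \<longleftrightarrow> (\<forall>\<sigma> \<tau>. P_symbol \<sigma> = P_symbol \<tau> \<longrightarrow> Poly_Mapping.lookup x \<sigma> = Poly_Mapping.lookup x \<tau>)" for x
    unfolding span_baxter_P by simp
  interpret connected_bialgebra "fq_mult :: 'k fqsym \<Rightarrow> _" fq_one fq_comult fq_counit perm_size
    by (rule fq_connected_bialgebra)
  show ?thesis
    unfolding fq_antipode_def
  proof (rule hopf_subalgebra)
    \<comment> \<open>The empty permutation is the only one of size 0, so it forms a fibre by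
      itself.\<close>
    show "fq_one \<in> ?V"
      unfolding V fq_one_def lookup_basis by (metis P_symbol_perm_size perm_size_eq_0_iff)
    show "fq_mult x y \<in> ?V" if "x \<in> ?V" "y \<in> ?V" for x y
      unfolding V
    proof (intro allI impI)
      fix \<pi> \<pi>' assume P: "P_symbol \<pi> = P_symbol \<pi>'"
      have "Poly_Mapping.lookup x (perm_lo k \<pi>) = Poly_Mapping.lookup x (perm_lo k \<pi>')"
        "Poly_Mapping.lookup y (perm_hi k \<pi>) = Poly_Mapping.lookup y (perm_hi k \<pi>')" for k
        using that[unfolded V] P_symbol_lo[OF P] P_symbol_hi[OF P] by blast+
      then show "Poly_Mapping.lookup (fq_mult x y) \<pi> = Poly_Mapping.lookup (fq_mult x y) \<pi>'"
        unfolding lookup_fq_mult P_symbol_perm_size[OF P] by (simp only:)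
    qed
    show "fq_comult x \<in> tensor_subspace ?V ?V" if "x \<in> ?V" for x
    proof (rule tensor_subspace_baxter_P)
      fix \<mu> \<mu>' \<nu> \<nu>'
      assume P: "P_symbol \<mu> = P_symbol \<mu>'" "P_symbol \<nu> = P_symbol \<nu>'"
      note size = P_symbol_perm_size[OF P(1)] P_symbol_perm_size[OF P(2)]
      show "Poly_Mapping.lookup (fq_comult x) (\<mu>, \<nu>) = Poly_Mapping.lookup (fq_comult x) (\<mu>', \<nu>')"
        unfolding lookup_fq_comult size[symmetric]
      proof (intro sum.cong refl)
        fix A assume "A \<in> {A. A \<subseteq> {1..perm_size \<mu> + perm_size \<nu>} \<and> card A = perm_size \<mu>}"
        then have "P_symbol (join A \<mu> \<nu>) = P_symbol (join A \<mu>' \<nu>')"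
          using P_symbol_join[OF _ _ P] by blast
        then show "Poly_Mapping.lookup x (join A \<mu> \<nu>) = Poly_Mapping.lookup x (join A \<mu>' \<nu>')"
          using that[unfolded V] by blast
      qed
    qed
  qed (rule fs.subspace_span)
qed

end
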